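(* Fix an integer $N$, non-constant polynomials $f_1(t),\ldots,f_n(t)\in\mathbb{Z}[t]$ with positive leading coefficients, and rational functions $g_0(t),g_1(t),\ldots,g_n(t)\in\mathbb{Q}(t)$. Set \[ M=\min_{0\le i\le n}\{v_t(g_i(t))\}. \] Suppose all of the following conditions hold: \begin{enumerate} \item \[ v_t\!\left(g_0(t)-\Big(1-\frac{1}{t}\Big)\sum_{\substack{i:\ f_i(1)=0}}g_i(t) -\sum_{\substack{i:\ f_i(1)\geq 2}}\big(1-t^{f_i(1)-1}\big) \frac{B_{f_i(1)}}{f_i(1)}\,g_i(t)\,f_i(t)\right)\geq N. \] \item For every even non-positive integer $k\in\{f_1(1),\ldots,f_n(1)\}$ and every integer $m$ with $1\leq m\leq N-M$, \[ v_t\!\left(\sum_{\substack{i:\ f_i(1)= k}} g_i(t)f_i(t)^m\right)\geq N+1-m. \] \item For every even positive integer $k\in\{f_1(1),\ldots,f_n(1)\}$ and every integer $m$ with $2\leq m\leq N-M$, \[ v_t\!\left(\sum_{\substack{i:\ f_i(1)= k}} g_i(t)\big(f_i(t)^m-k^{m-1}f_i(t)\big)\right)\geq N+1-m. \] \end{enumerate} Then there exists $P$ such that for every prime $p>P$, \[ \sum_{i=1}^n g_i(p)B_{f_i(p)}\equiv g_0(p)\pmod{p^N}. \]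
   Context: The Bernoulli numbers $B_n\in\mathbb{Q}$ are defined by $\frac{x}{e^x-1}=\sum_{n\ge0}B_n\frac{x^n}{n!}$. For a prime $p$ and rational numbers $a,b$, the congruence $a\equiv b\pmod{p^N}$ means $v_p(a-b)\ge N$, where $v_p$ is the $p$-adic valuation (i.e. congruence modulo $p^N\mathbb{Z}_{(p)}$). $v_t$ denotes the $t$-adic valuation on $\mathbb{Q}(t)$, i.e. $v_t(t^e a(t)/b(t))=e$ for $a,b\in\mathbb{Q}[t]$ with $a(0)b(0)\ne0$, and $v_t(0)=+\infty$. Sums over an empty index set are $0$. For large primes $p$, the values $g_i(p)$ are defined (no pole at $p$). *)

theory Defs
  imports "HOL-Computational_Algebra.Computational_Algebra" "HOL-Computational_Algebra.Field_as_Ring" "HOL-Library.Extended_Real"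
begin

definition bernoulli :: "nat \<Rightarrow> rat" where
  "bernoulli n = fact n * fps_nth (fps_X / (fps_exp 1 - 1) :: rat fps) n"

definition rf_t :: "rat poly fract" where
  "rf_t = to_fract [:0, 1:]"

definition rf_of_int_poly :: "int poly \<Rightarrow> rat poly fract" where
  "rf_of_int_poly f = to_fract (map_poly rat_of_int f)"

definition rf_const :: "rat \<Rightarrow> rat poly fract" where
  "rf_const c = to_fract [:c:]"

definition v_t :: "rat poly fract \<Rightarrow> ereal" where
  "v_t g = (if g = 0 then \<infinity> else
     ereal (of_int (int (order 0 (fst (quot_of_fract g))) - int (order 0 (snd (quot_of_fract g))))))"

text \<open>Evaluation of a rational function at an integer point (reduced numerator over reduced
  denominator; well defined away from the finitely many poles).\<close>
definition rf_eval :: "rat poly fract \<Rightarrow> rat \<Rightarrow> rat" where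
  "rf_eval g x = poly (fst (quot_of_fract g)) x / poly (snd (quot_of_fract g)) x"

text \<open>p-adic valuation on Q (value for 0 is irrelevant, see congruence below).\<close>
definition padic_val_rat :: "nat \<Rightarrow> rat \<Rightarrow> int" where
  "padic_val_rat p q = (let (a, b) = quotient_of q in
      int (multiplicity (int p) a) - int (multiplicity (int p) b))"

text \<open>a = b mod p^N in Z_(p): v_p(a - b) \<ge> N, where v_p(0) = +infinity.\<close>
definition cong_padic :: "rat \<Rightarrow> rat \<Rightarrow> nat \<Rightarrow> int \<Rightarrow> bool" where
  "cong_padic a b p N \<longleftrightarrow> a = b \<or> padic_val_rat p (a - b) \<ge> N"

end

theory Submission
  imports "HOL-Number_Theory.Residue_Primitive_Roots" Defs
begin

text \<open>
  For a fixed residue class \<open>k\<close> modulo \<open>p - 1\<close>, the function \<open>n \<mapsto> (1 - p^(n-1)) B_n\<close>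
  agrees modulo \<open>p^K\<close> with a polynomial \<open>e_0 + e_1 n + \<dots> + e_K n^K\<close> where \<open>v_p(e_m) \<ge> m - 1\<close>
  for \<open>m \<ge> 1\<close> and \<open>e_0\<close> is \<open>1 - 1/p\<close> or \<open>0\<close> according to whether \<open>p - 1\<close> divides \<open>k\<close>.
  Indeed \<open>(1 - p^(n-1)) B_n\<close> is \<open>p\<close>-adically close to \<open>p^(-r) \<Sum> a^n\<close> over the units \<open>a < p^r\<close>.
  Writing \<open>a = \<omega>(a) (1 + p u)\<close> with a Teichmueller-like factor \<open>\<omega>(a)\<close> and expanding \<open>(1 + p u)^n\<close>
  binomially makes the dependence on \<open>n\<close> polynomial. The power sums over the lifts of a fixed residue
  class supply the remaining powers of \<open>p\<close>.
  Substituting \<open>n = f_i(p)\<close> and summing over the \<open>i\<close> with \<open>f_i(1) = k\<close>, the second and third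
  conditions make every non-leading term vanish modulo \<open>p^N\<close>, and the first one accounts for the
  leading terms. For \<open>k > 0\<close> the coefficient \<open>e_1\<close> is eliminated by comparison with \<open>n = k\<close>.
\<close>

section \<open>Lower bounds for the p-adic valuation\<close>

text \<open>Stated through a witness instead of \<open>padic_val_rat\<close>: 0 then satisfies every
  bound, N may be negative, and closure under sums and products follows from arithmetic on the
  witnesses.\<close>

definition vp_ge :: "nat \<Rightarrow> int \<Rightarrow> rat \<Rightarrow> bool" where
  "vp_ge p N x \<longleftrightarrow> (\<exists>a b. \<not> int p dvd b \<and> x = of_int a / of_int b * of_nat p powi N)"

lemma vp_geI:
  assumes "\<not> int p dvd b" "x = of_int a / of_int b * of_nat p powi N"
  shows "vp_ge p N x"
  using assms unfolding vp_ge_def by blast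

context
  fixes p :: nat
  assumes p: "prime p"
begin

lemma p_nonzero: "(of_nat p :: rat) \<noteq> 0"
  using p by auto

lemma prime_int_p: "prime (int p)"
  using p by simp

lemma vp_ge_mono:
  assumes "vp_ge p N x" "N' \<le> N"
  shows "vp_ge p N' x"
proof -
  from assms(1) obtain a b where ab: "\<not> int p dvd b" "x = of_int a / of_int b * of_nat p powi N"
    unfolding vp_ge_def by blast
  have "(of_nat p :: rat) powi N = of_nat p powi (int (nat (N - N')) + N')"
    using assms(2) by simp
  also have "\<dots> = of_int (int p ^ nat (N - N')) * of_nat p powi N'"
    by (subst power_int_add) (use p_nonzero in \<open>auto simp flip: power_int_of_nat\<close>)
  finally show ?thesis using ab
    by (intro vp_geI[of p b _ "a * int p ^ nat (N - N')"]) auto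
qed

lemma vp_ge_0 [simp]: "vp_ge p N 0"
  by (rule vp_geI[of p 1 _ 0]) (use prime_int_p not_prime_unit in auto)

lemma vp_ge_add:
  assumes "vp_ge p N x" "vp_ge p N y"
  shows "vp_ge p N (x + y)"
proof -
  from assms obtain a b c d where ab: "\<not> int p dvd b" "x = of_int a / of_int b * of_nat p powi N"
    and cd: "\<not> int p dvd d" "y = of_int c / of_int d * of_nat p powi N"
    unfolding vp_ge_def by blast
  have "of_int b \<noteq> (0::rat)" "of_int d \<noteq> (0::rat)"
    using ab cd by auto
  then show ?thesis
    by (intro vp_geI[of p "b * d" _ "a * d + c * b"])
       (use ab cd prime_int_p in \<open>auto simp: prime_dvd_mult_iff field_simps\<close>)
qed

lemma vp_ge_mult:
  assumes "vp_ge p N x" "vp_ge p N' y"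
  shows "vp_ge p (N + N') (x * y)"
proof -
  from assms obtain a b c d where ab: "\<not> int p dvd b" "x = of_int a / of_int b * of_nat p powi N"
    and cd: "\<not> int p dvd d" "y = of_int c / of_int d * of_nat p powi N'"
    unfolding vp_ge_def by blast
  show ?thesis
    by (rule vp_geI[of p "b * d" _ "a * c"])
       (use ab cd prime_int_p p_nonzero in \<open>auto simp: prime_dvd_mult_iff power_int_add\<close>)
qed

lemma vp_ge_mult':
  assumes "vp_ge p A x" "vp_ge p B y" "N \<le> A + B"
  shows "vp_ge p N (x * y)"
  using vp_ge_mono[OF vp_ge_mult[OF assms(1,2)] assms(3)] .

lemma vp_ge_uminus:
  assumes "vp_ge p N x"
  shows "vp_ge p N (- x)"
proof -
  from assms obtain a b where "\<not> int p dvd b" "x = of_int a / of_int b * of_nat p powi N"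
    unfolding vp_ge_def by blast
  then show ?thesis by (intro vp_geI[of p b _ "- a"]) auto
qed

lemma vp_ge_diff:
  assumes "vp_ge p N x" "vp_ge p N y"
  shows "vp_ge p N (x - y)"
  using vp_ge_add[OF assms(1) vp_ge_uminus[OF assms(2)]] by simp

lemma vp_ge_sum:
  assumes "\<And>i. i \<in> A \<Longrightarrow> vp_ge p N (h i)"
  shows "vp_ge p N (\<Sum>i\<in>A. h i)"
  using assms by (induction A rule: infinite_finite_induct) (auto intro: vp_ge_add)

lemma vp_ge_of_int [simp]: "vp_ge p 0 (of_int a)"
  by (rule vp_geI[of p 1 _ a]) (use prime_int_p not_prime_unit in auto)

lemma vp_ge_of_nat [simp]: "vp_ge p 0 (of_nat a)"
  using vp_ge_of_int[of "int a"] by simp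

lemma vp_ge_powi: "vp_ge p N (of_nat p powi N)"
  by (rule vp_geI[of p 1 _ 1]) (use prime_int_p not_prime_unit in auto)

lemma vp_ge_p_power: "vp_ge p (int k) (of_nat p ^ k)"
  using vp_ge_powi[of "int k"] by simp

lemma vp_ge_of_int_dvd:
  assumes "int p ^ k dvd a"
  shows "vp_ge p (int k) (of_int a)"
proof -
  from assms obtain c where "a = int p ^ k * c" by blast
  then show ?thesis
    using vp_ge_mult[OF vp_ge_p_power[of k] vp_ge_of_int[of c]] by simp
qed

lemma vp_ge_inverse_of_int:
  assumes "\<not> int p dvd a"
  shows "vp_ge p 0 (1 / of_int a)"
  by (rule vp_geI[of p a _ 1]) (use assms in auto)

lemma vp_ge_power:
  assumes "vp_ge p 0 x"
  shows "vp_ge p 0 (x ^ k)"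
proof (induction k)
  case 0
  show ?case using vp_ge_of_int[of 1] by simp
next
  case (Suc k)
  then show ?case using vp_ge_mult[OF assms Suc] by simp
qed

lemma vp_ge_divide_power:
  assumes "vp_ge p (N + int k) x"
  shows "vp_ge p N (x / of_nat p ^ k)"
proof -
  have "x / of_nat p ^ k = x * of_nat p powi (- int k)"
    by (simp add: power_int_minus divide_inverse)
  then show ?thesis
    using vp_ge_mult[OF assms vp_ge_powi[of "- int k"]] by simp
qed

text \<open>If p^v divides j + 1 then v < p^v \<le> j + 1. The bound is crude, but the factor
  p^(j+1) accompanying 1/(j+1) in the power sum formula absorbs it.\<close>

lemma vp_ge_inverse_Suc: "vp_ge p (- int j) (1 / of_nat (Suc j))"
proof -
  have pgt: "p > 1" using p prime_gt_1_nat by blast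
  obtain u where u: "Suc j = p ^ multiplicity p (Suc j) * u" "\<not> p dvd u"
    using multiplicity_decompose'[of "Suc j" p] p pgt not_prime_unit by (metis nat.simps(3))
  define v where "v = multiplicity p (Suc j)"
  have "u > 0" using u by (cases u) auto
  then have "p ^ v \<le> Suc j" using u(1) unfolding v_def by (metis mult.right_neutral mult_le_mono2 Suc_leI One_nat_def)
  moreover have "v < p ^ v" by (rule power_gt_expt) (use pgt in simp)
  ultimately have "v \<le> j" by linarith
  have "(1 / of_nat (Suc j) :: rat) = (1 / of_int (int u)) / of_nat p ^ v"
    by (subst u(1)) (simp add: v_def)
  moreover have "vp_ge p (- int v) ((1 / of_int (int u)) / of_nat p ^ v)"
    using u(2) by (intro vp_ge_divide_power) (simp add: vp_ge_inverse_of_int del: of_int_of_nat_eq)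
  ultimately show ?thesis using \<open>v \<le> j\<close> vp_ge_mono by (metis neg_le_iff_le of_nat_le_iff)
qed

text \<open>The bridge back to the valuation on reduced fractions: clearing denominators gives an
  identity of integers, whose multiplicities at p are then compared.\<close>

lemma vp_ge_imp_cong_padic:
  assumes "vp_ge p N (a - b)"
  shows "cong_padic a b p N"
proof (cases "a = b")
  case True
  then show ?thesis by (simp add: cong_padic_def)
next
  case False
  define x where "x = a - b"
  have x0: "x \<noteq> 0" using False by (simp add: x_def)
  obtain c d where cd: "\<not> int p dvd d" "x = of_int c / of_int d * of_nat p powi N"
    using assms unfolding vp_ge_def x_def by blast
  have d0: "d \<noteq> 0" using cd by auto
  have c0: "c \<noteq> 0" using cd x0 by auto
  obtain A B where AB: "quotient_of x = (A, B)" by fastforce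
  have B: "B > 0" "x = of_int A / of_int B"
    using quotient_of_denom_pos[OF AB] quotient_of_div[OF AB] by auto
  have A0: "A \<noteq> 0" using x0 B by auto
  have pe: "prime_elem (int p)" using prime_int_p by auto
  have nu: "\<not> is_unit (int p)" using prime_int_p not_prime_unit by blast
  have mm: "multiplicity (int p) (u * int p ^ k) = multiplicity (int p) u + k" if "u \<noteq> 0" for u k
    using that pe nu p by (subst prime_elem_multiplicity_mult_distrib) auto
  have md: "multiplicity (int p) d = 0" using cd by (simp add: not_dvd_imp_multiplicity_0)
  \<comment> \<open>N = k - l with natural k and l, so that p^N becomes p^k on one side and p^l on
    the other and no negative exponent remains.\<close>
  define k l where "k = nat N" and "l = nat (- N)"
  have "(of_nat p :: rat) powi N * of_nat p ^ l = of_nat p ^ k"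
  proof -
    have "(of_nat p :: rat) powi N * of_nat p powi (int l) = of_nat p powi (int k)"
      using p_nonzero by (subst power_int_add[symmetric]) (auto simp: k_def l_def)
    then show ?thesis by simp
  qed
  then have eq: "x * of_nat p ^ l * of_int d = of_int c * of_nat p ^ k"
    unfolding \<open>(of_nat p :: rat) powi N * of_nat p ^ l = of_nat p ^ k\<close>[symmetric]
    using d0 by (subst cd(2)) (simp add: field_simps)
  have "of_int (A * d * int p ^ l) = (of_int (B * c * int p ^ k) :: rat)"
    using eq B by (simp add: field_simps)
  then have "A * d * int p ^ l = B * c * int p ^ k" by (simp only: of_int_eq_iff)
  then have "multiplicity (int p) (A * d * int p ^ l) = multiplicity (int p) (B * c * int p ^ k)"
    by simp
  then have "multiplicity (int p) A + l = multiplicity (int p) B + multiplicity (int p) c + k"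
    using A0 B(1) c0 d0 pe md
    by (subst (asm) (1 2) mm) (auto simp: prime_elem_multiplicity_mult_distrib)
  then show ?thesis
    by (auto simp: cong_padic_def padic_val_rat_def AB[unfolded x_def] k_def l_def)
qed

end

section \<open>Bernoulli numbers and power sums\<close>

text \<open>The division in \<open>bernoulli\<close> is exact: \<open>fps_exp 1 - 1\<close> has
  subdegree 1, hence divides X.\<close>

lemma bernoulli_fps: "(fps_exp 1 - 1) * Abs_fps (\<lambda>n. bernoulli n / fact n) = (fps_X :: rat fps)"
proof -
  have *: "(fps_exp 1 - 1 :: rat fps) \<noteq> 0" by simp
  have sd: "subdegree (fps_exp 1 - 1 :: rat fps) = 1"
    by (rule subdegreeI) auto
  have "Abs_fps (\<lambda>n. bernoulli n / fact n) = fps_X / (fps_exp 1 - 1)"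
    by (simp add: bernoulli_def fps_eq_iff)
  moreover have "(fps_exp 1 - 1 :: rat fps) dvd fps_X"
    using * sd by (subst fps_dvd_iff) auto
  ultimately show ?thesis by simp
qed

text \<open>The generating function satisfies F(-X) = F(X) + X, obtained by substituting -X and
  multiplying by e^X; the coefficients of X^n give (-1)^n B_n = B_n for n \<noteq> 1.\<close>

lemma bernoulli_odd_eq_0:
  assumes "odd n" "n \<noteq> 1"
  shows "bernoulli n = 0"
proof -
  define F where "F = Abs_fps (\<lambda>n. bernoulli n / fact n)"
  define E where "E = (fps_exp 1 :: rat fps)"
  define G where "G = F oo (fps_const (-1) * fps_X)"
  have F: "(E - 1) * F = fps_X" unfolding E_def F_def by (rule bernoulli_fps)
  have "((E - 1) * F) oo (fps_const (-1) * fps_X) = fps_X oo (fps_const (-1) * fps_X)"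
    by (simp add: F)
  then have "(fps_exp (-1) - 1) * G = - fps_X"
    by (simp add: fps_compose_mult_distrib fps_compose_sub_distrib E_def G_def)
  then have "E * (fps_exp (-1) - 1) * G = - (E * fps_X)"
    by (simp add: mult.assoc)
  moreover have "E * fps_exp (-1) = 1"
    using fps_exp_add_mult[of "1::rat" "-1"] by (simp add: E_def)
  ultimately have "(E - 1) * G = E * fps_X" by (simp add: algebra_simps)
  also have "\<dots> = (E - 1) * (F + fps_X)" using F by (simp add: algebra_simps)
  finally have "G = F + fps_X" by (simp add: E_def)
  then have "fps_nth G n = fps_nth F n + fps_nth fps_X n" by simp
  then show ?thesis using assms by (simp add: G_def F_def)
qed

text \<open>Faulhaber's formula. The geometric sum S of e^(aX) satisfies (e^X - 1) S = e^(MX) - 1,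
  so X S = F (e^(MX) - 1); compare coefficients of X^(n+1).\<close>

lemma sum_power_eq_bernoulli:
  "(\<Sum>a<M. of_nat a ^ n) =
     (\<Sum>i\<le>n. of_nat (n choose i) * bernoulli i * of_nat M ^ Suc (n - i) / of_nat (Suc (n - i)))"
proof -
  define F where "F = Abs_fps (\<lambda>n. bernoulli n / fact n)"
  define S where "S = (\<Sum>a<M. fps_exp (of_nat a) :: rat fps)"
  have F: "(fps_exp 1 - 1) * F = fps_X" unfolding F_def by (rule bernoulli_fps)
  have "(fps_exp 1 - 1) * S = fps_exp (of_nat M) - 1"
    unfolding S_def
    by (induction M) (simp_all add: algebra_simps flip: fps_exp_add_mult)
  then have "(fps_exp 1 - 1) * (fps_X * S) = (fps_exp 1 - 1) * (F * (fps_exp (of_nat M) - 1))"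
    using F by (metis mult.assoc mult.commute)
  then have "fps_X * S = F * (fps_exp (of_nat M) - 1)" by simp
  then have "fps_nth (fps_X * S) (Suc n) = fps_nth (F * (fps_exp (of_nat M) - 1)) (Suc n)" by simp
  then have "(\<Sum>a<M. of_nat a ^ n / fact n) =
      (\<Sum>i\<le>n. bernoulli i / fact i * (of_nat M ^ Suc (n - i) / fact (Suc (n - i))))"
    by (simp add: S_def F_def fps_sum_nth fps_mult_nth[of "Abs_fps _"] atLeast0AtMost Suc_diff_le
          mult.commute[of "fact _" "fact _"] del: power_Suc fact_Suc)
  then have "(\<Sum>a<M. of_nat a ^ n) = fact n *
      (\<Sum>i\<le>n. bernoulli i / fact i * (of_nat M ^ Suc (n - i) / fact (Suc (n - i))))"
    by (simp add: field_simps flip: sum_divide_distrib)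
  also have "\<dots> = (\<Sum>i\<le>n. of_nat (n choose i) * bernoulli i * of_nat M ^ Suc (n - i) / of_nat (Suc (n - i)))"
    unfolding sum_distrib_left
    by (intro sum.cong refl) (simp add: binomial_fact field_simps)
  finally show ?thesis .
qed

text \<open>The integrality half of von Staudt-Clausen. Faulhaber's formula with M = p is solved for
  p B_n; with j = n - i > 0, the term of B_i has valuation at least -1 + (j + 1) - j = 0 by
  induction.\<close>

lemma vp_ge_bernoulli:
  assumes p: "prime p"
  shows "vp_ge p (-1) (bernoulli n)"
proof (induction n rule: less_induct)
  case (less n)
  define R where "R = (\<Sum>i<n. of_nat (n choose i) * bernoulli i * of_nat p ^ Suc (n - i) / of_nat (Suc (n - i)))"
  have "(\<Sum>a<p. of_nat a ^ n) = R + bernoulli n * of_nat p"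
    by (simp add: sum_power_eq_bernoulli R_def flip: lessThan_Suc_atMost)
  then have eq: "bernoulli n = ((\<Sum>a<p. of_nat a ^ n) - R) / of_nat p ^ 1"
    using p_nonzero[OF p] by (simp add: field_simps)
  have "vp_ge p 0 R"
    unfolding R_def
  proof (intro vp_ge_sum[OF p])
    fix i assume "i \<in> {..<n}"
    then have "vp_ge p (0 + - 1 + (int (Suc (n - i)) + - int (n - i)))
        (of_nat (n choose i) * bernoulli i * (of_nat p ^ Suc (n - i) * (1 / of_nat (Suc (n - i)))))"
      by (intro vp_ge_mult vp_ge_of_nat less vp_ge_p_power vp_ge_inverse_Suc p) simp
    then show "vp_ge p 0 (of_nat (n choose i) * bernoulli i * of_nat p ^ Suc (n - i) / of_nat (Suc (n - i)))"
      by simp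
  qed
  then show ?case
    unfolding eq
    by (intro vp_ge_divide_power vp_ge_diff p vp_ge_sum) (auto intro!: vp_ge_power vp_ge_of_nat p)
qed

text \<open>In Faulhaber's formula with M = p^r, divided by p^r, the term i = n is B_n itself. A
  term with j = n - i \<ge> 1 has valuation at least r j - 1 - j, which is at least r - 2.\<close>

lemma bernoulli_cong_sum_power:
  assumes p: "prime p" and r: "r \<ge> 1"
  shows "vp_ge p (int r - 2) ((\<Sum>a<p^r. of_nat a ^ n) / of_nat p ^ r - bernoulli n)"
proof -
  have "(\<Sum>a<p^r. of_nat a ^ n) / of_nat p ^ r - bernoulli n =
     (\<Sum>i<n. of_nat (n choose i) * bernoulli i * of_nat (p^r) ^ Suc (n - i) / of_nat (Suc (n - i))) / of_nat p ^ r"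
    using p_nonzero[OF p]
    by (simp add: sum_power_eq_bernoulli add_divide_distrib flip: lessThan_Suc_atMost)
  also have "\<dots> = (\<Sum>i<n. of_nat (n choose i) * bernoulli i * (of_nat p ^ (r * (n - i)) * (1 / of_nat (Suc (n - i)))))"
    using p_nonzero[OF p]
    unfolding sum_divide_distrib
    by (intro sum.cong refl) (simp add: power_mult)
  also have "vp_ge p (int r - 2) \<dots>"
  proof (intro vp_ge_sum[OF p])
    fix i assume "i \<in> {..<n}"
    then obtain j where j: "n - i = Suc j" by (metis Suc_diff_Suc lessThan_iff)
    have "int r - 2 \<le> 0 + - 1 + (int (r * Suc j) + - int (Suc j))"
      using mult_right_mono[of 1 "int r" "int j"] r by (simp add: algebra_simps)
    moreover have "vp_ge p (0 + - 1 + (int (r * Suc j) + - int (Suc j)))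
        (of_nat (n choose i) * bernoulli i * (of_nat p ^ (r * Suc j) * (1 / of_nat (Suc (Suc j)))))"
      by (intro vp_ge_mult vp_ge_of_nat vp_ge_bernoulli vp_ge_p_power vp_ge_inverse_Suc p)
    ultimately show "vp_ge p (int r - 2) (of_nat (n choose i) * bernoulli i *
         (of_nat p ^ (r * (n - i)) * (1 / of_nat (Suc (n - i)))))"
      unfolding j using vp_ge_mono[OF p] by blast
  qed
  finally show ?thesis .
qed

text \<open>The multiples of p contribute p^(n-1) times the normalised power sum one level lower.
  Removing them therefore produces the Euler factor, and only units remain in the sum.\<close>

lemma euler_factor_bernoulli_cong:
  assumes p: "prime p" and n: "n > 0" and r: "r \<ge> 1"
  shows "vp_ge p (int r - 2) (((\<Sum>a<p^Suc r. of_nat a ^ n) - (\<Sum>a<p^r. of_nat (p * a) ^ n)) / of_nat p ^ Suc r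
           - (1 - of_nat p ^ (n - 1)) * bernoulli n)"
proof -
  have eq: "(\<Sum>a<p^r. of_nat (p * a) ^ n) / of_nat p ^ Suc r = (of_nat p ^ (n-1) * ((\<Sum>a<p^r. of_nat a ^ n) / of_nat p ^ r) :: rat)"
    using n p_nonzero[OF p]
    by (cases n) (simp_all add: power_mult_distrib field_simps sum_distrib_left)
  have 1: "vp_ge p (int r - 2) ((\<Sum>a<p^Suc r. of_nat a ^ n) / of_nat p ^ Suc r - bernoulli n)"
    by (rule vp_ge_mono[OF p bernoulli_cong_sum_power[OF p]]) auto
  have 2: "vp_ge p (int r - 2) (of_nat p ^ (n-1) * ((\<Sum>a<p^r. of_nat a ^ n) / of_nat p ^ r - bernoulli n))"
    by (rule vp_ge_mult'[OF p vp_ge_p_power[OF p] bernoulli_cong_sum_power[OF p r]]) auto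
  show ?thesis
    using vp_ge_diff[OF p 1 2] unfolding diff_divide_distrib eq by (simp add: algebra_simps)
qed

section \<open>Power sums over units\<close>

text \<open>The telescoped form of (b+1)^(i+1) - b^(i+1): an integral recursion for power sums that
  is free of denominators.\<close>

lemma sum_binomial_power_sums:
  "(\<Sum>j\<le>i. of_nat (Suc i choose j) * (\<Sum>b<M. int b ^ j)) = int M ^ Suc i"
proof (induction M)
  case 0
  show ?case by simp
next
  case (Suc M)
  have "(int M + 1) ^ Suc i = (\<Sum>j\<le>Suc i. of_nat (Suc i choose j) * int M ^ j)"
    by (subst binomial_ring) simp
  then have "(int M + 1) ^ Suc i = (\<Sum>j\<le>i. of_nat (Suc i choose j) * int M ^ j) + int M ^ Suc i"
    by simp
  then show ?case using Suc
    by (simp add: distrib_left sum.distrib algebra_simps)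
qed

text \<open>The recursion expresses (i+1) times the i-th power sum through lower ones modulo p^s,
  and i + 1 < p is invertible.\<close>

lemma prime_power_dvd_sum_power:
  assumes p: "prime p" and "Suc i < p"
  shows "int p ^ s dvd (\<Sum>b<p^s. int b ^ i)"
  using assms(2)
proof (induction i rule: less_induct)
  case (less i)
  let ?S = "\<lambda>j. \<Sum>b<p^s. int b ^ j"
  have "(\<Sum>j<i. of_nat (Suc i choose j) * ?S j) + int (Suc i) * ?S i = int (p^s) ^ Suc i"
    using sum_binomial_power_sums[of i "p^s"] by (simp flip: lessThan_Suc_atMost)
  then have "int (Suc i) * ?S i = int (p^s) ^ Suc i - (\<Sum>j<i. of_nat (Suc i choose j) * ?S j)"
    by linarith
  moreover have "int p ^ s dvd (\<Sum>j<i. of_nat (Suc i choose j) * ?S j)"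
    by (intro dvd_sum dvd_mult less.IH) (use less.prems in auto)
  moreover have "int p ^ s dvd int (p^s) ^ Suc i" by simp
  ultimately have "int p ^ s dvd int (Suc i) * ?S i" by (simp only: dvd_diff)
  moreover have "\<not> p dvd Suc i" using less.prems by (auto dest: dvd_imp_le)
  then have "coprime p (Suc i)" using p by (intro prime_imp_coprime_nat)
  then have "coprime (int p) (int (Suc i))" by (simp only: coprime_int_iff)
  then have "coprime (int p ^ s) (int (Suc i))" unfolding coprime_power_left_iff by blast
  ultimately show ?case by (simp add: coprime_dvd_mult_right_iff)
qed

text \<open>Supplies the factor p^s gained by summing over all p^s lifts of a fixed residue class;
  binomial expansion in b reduces it to plain power sums.\<close>

lemma prime_power_dvd_sum_linear_power:
  assumes p: "prime p" and "Suc j < p"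
  shows "int p ^ s dvd (\<Sum>b<p^s. (q + int b * T) ^ j)"
proof -
  have "(\<Sum>b<p^s. (q + int b * T) ^ j) =
      (\<Sum>b<p^s. \<Sum>i\<le>j. of_nat (j choose i) * (int b * T) ^ i * q ^ (j - i))"
    by (subst add.commute) (simp only: binomial_ring)
  also have "\<dots> = (\<Sum>i\<le>j. \<Sum>b<p^s. of_nat (j choose i) * (int b * T) ^ i * q ^ (j - i))"
    by (rule sum.swap)
  also have "\<dots> = (\<Sum>i\<le>j. of_nat (j choose i) * T ^ i * q ^ (j - i) * (\<Sum>b<p^s. int b ^ i))"
    by (simp add: sum_distrib_left power_mult_distrib mult_ac)
  also have "int p ^ s dvd \<dots>"
    using assms by (intro dvd_sum dvd_mult prime_power_dvd_sum_power) auto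
  finally show ?thesis .
qed

text \<open>Each p-th power gains one factor p: in x^p - y^p = (x - y) \<Sum> y^(p-1-i) x^i the sum
  is p y^(p-1) modulo p, hence 0.\<close>

lemma cong_power_prime_power:
  fixes a b :: int
  assumes "[a = b] (mod int p)"
  shows "[a ^ (p ^ R) = b ^ (p ^ R)] (mod int p ^ Suc R)"
proof (induction R)
  case 0
  show ?case using assms by simp
next
  case (Suc R)
  define x y where "x = a ^ (p ^ R)" and "y = b ^ (p ^ R)"
  have xy: "[x = y] (mod int p ^ Suc R)" using Suc by (simp add: x_def y_def)
  then have xyp: "[x = y] (mod int p)" by (rule cong_dvd_modulus) simp
  have "[(\<Sum>i<p. y ^ (p - Suc i) * x ^ i) = (\<Sum>i<p. y ^ (p - Suc i) * y ^ i)] (mod int p)"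
    by (intro cong_sum cong_mult cong_pow xyp cong_refl)
  also have "(\<Sum>i<p. y ^ (p - Suc i) * y ^ i) = (\<Sum>i<p. y ^ (p - 1))"
    by (intro sum.cong refl) (auto simp flip: power_add)
  also have "[(\<Sum>i<p. y ^ (p - 1)) = 0] (mod int p)" by (simp add: cong_0_iff)
  finally have "int p dvd (\<Sum>i<p. y ^ (p - Suc i) * x ^ i)" by (simp add: cong_0_iff)
  then have "int p ^ Suc R * int p dvd (x - y) * (\<Sum>i<p. y ^ (p - Suc i) * x ^ i)"
    using xy by (intro mult_dvd_mono) (auto simp: cong_iff_dvd_diff)
  then have "[x ^ p = y ^ p] (mod int p ^ Suc (Suc R))"
    by (simp add: cong_iff_dvd_diff power_diff_sumr2 mult.commute)
  then show ?case by (simp add: x_def y_def mult.commute flip: power_mult)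
qed

text \<open>Multiplication by a primitive root g permutes the nonzero residues, and a p^R-th power
  modulo p^(R+1) depends only on the residue. Hence (g^e - 1) S = 0 modulo p^(R+1) for e = p^R k.
  The factor g^e - 1 is a unit, because p - 1 is coprime to p^R and does not divide k.\<close>

lemma cong_sum_power_residues_0:
  assumes p: "prime p" and k: "\<not> (p - 1) dvd k"
  shows "[(\<Sum>a=1..<p. int a ^ (p ^ R * k)) = 0] (mod int p ^ Suc R)"
proof -
  obtain g where g: "residue_primroot p g" using prime_primitive_root_exists[of p] p
prime_gt_1_nat by blast
  have cop: "coprime p g" and og: "ord p g = p - 1"
    using g p by (auto simp: residue_primroot_def totient_prime)
  define e where "e = p ^ R * k"
  define S where "S = (\<Sum>a=1..<p. int a ^ e)"
  have p1: "p > 1" using p prime_gt_1_nat by blast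
  have img: "(\<lambda>a. g * a mod p) ` {1..<p} \<subseteq> {1..<p}"
  proof safe
    fix a assume a: "a \<in> {1..<p}"
    have "\<not> p dvd g" using cop p p1 by (metis coprime_absorb_left nat_dvd_1_iff_1 less_numeral_extra(4))
    moreover have "\<not> p dvd a" using a by (auto dest: dvd_imp_le)
    ultimately have "g * a mod p \<noteq> 0" using p prime_dvd_mult_iff by (auto simp: mod_eq_0_iff_dvd)
    then show "g * a mod p \<in> {1..<p}" using p1 by (simp add: Suc_le_eq)
  qed
  have inj: "inj_on (\<lambda>a. g * a mod p) {1..<p}"
  proof
    fix a b assume ab: "a \<in> {1..<p}" "b \<in> {1..<p}" "g * a mod p = g * b mod p"
    then have "[g * a = g * b] (mod p)" by (simp add: cong_def)
    then have "[a = b] (mod p)" using cop by (simp add: cong_mult_lcancel_nat coprime_commute)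
    then show "a = b" using ab by (simp add: cong_def)
  qed
  have bij: "bij_betw (\<lambda>a. g * a mod p) {1..<p} {1..<p}"
    using endo_inj_surj[OF _ img inj] inj by (simp add: bij_betw_def)
  have "S = (\<Sum>a=1..<p. int (g * a mod p) ^ e)"
    unfolding S_def by (rule sum.reindex_bij_betw[OF bij, symmetric])
  also have "[\<dots> = (\<Sum>a=1..<p. int (g * a) ^ e)] (mod int p ^ Suc R)"
    unfolding e_def power_mult
    by (intro cong_sum cong_pow cong_power_prime_power) (simp add: cong_def zmod_int)
  also have "(\<Sum>a=1..<p. int (g * a) ^ e) = int g ^ e * S"
    by (simp add: S_def sum_distrib_left power_mult_distrib)
  finally have "int p ^ Suc R dvd (int g ^ e - 1) * S"
    by (simp add: cong_iff_dvd_diff dvd_diff_commute algebra_simps)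
  moreover have "\<not> int p dvd int g ^ e - 1"
  proof
    assume "int p dvd int g ^ e - 1"
    then have "[int (g ^ e) = int 1] (mod int p)" by (simp add: cong_iff_dvd_diff)
    then have "[g ^ e = 1] (mod p)" by (simp only: cong_int_iff)
    then have "p - 1 dvd p ^ R * k" using og ord_divides[of g e p] by (simp only: e_def)
    moreover have "coprime (p - 1) (p ^ R)"
      using p1 coprime_diff_one_left_nat[of p] by (simp add: coprime_power_right_iff)
    ultimately show False using k by (simp add: coprime_dvd_mult_right_iff)
  qed
  then have "coprime (int p ^ Suc R) (int g ^ e - 1)"
    using p by (intro coprime_power_left_iff[THEN iffD2] disjI1 prime_imp_coprime) auto
  ultimately have "int p ^ Suc R dvd S" by (simp add: coprime_dvd_mult_right_iff)
  then show ?thesis by (simp add: S_def e_def cong_0_iff)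
qed

lemma fermat_int:
  assumes "prime p" "a \<in> {1..<p}"
  shows "[int a ^ (p - 1) = 1] (mod int p)"
proof -
  have "[a ^ (p - 1) = 1] (mod p)"
    using assms by (intro fermat_theorem) (auto dest: dvd_imp_le)
  then have "[int (a ^ (p - 1)) = int 1] (mod int p)" by (simp only: cong_int_iff)
  then show ?thesis by simp
qed

lemma binomial_expansion_cong:
  "[(1 + int p * x) ^ n = (\<Sum>j<J. of_nat (n choose j) * (int p ^ j * x ^ j))] (mod int p ^ J)"
proof -
  have "(1 + int p * x) ^ n = (\<Sum>j\<le>n. of_nat (n choose j) * (int p ^ j * x ^ j))"
    by (subst add.commute, subst binomial_ring) (simp add: power_mult_distrib)
  \<comment> \<open>Padding with vanishing binomial coefficients lets the sum be split at J whether
    or not J exceeds n.\<close>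
  also have "\<dots> = (\<Sum>j<J + Suc n. of_nat (n choose j) * (int p ^ j * x ^ j))"
    by (rule sum.mono_neutral_left) auto
  also have "\<dots> = (\<Sum>j<J. of_nat (n choose j) * (int p ^ j * x ^ j))
      + (\<Sum>j=J..<J + Suc n. of_nat (n choose j) * (int p ^ j * x ^ j))"
    by (simp only: lessThan_atLeast0 sum.atLeastLessThan_concat[of 0 J] le0 le_add1)
  finally have "(1 + int p * x) ^ n - (\<Sum>j<J. of_nat (n choose j) * (int p ^ j * x ^ j)) =
      (\<Sum>j=J..<J + Suc n. of_nat (n choose j) * (int p ^ j * x ^ j))" by simp
  moreover have "int p ^ J dvd \<dots>"
    by (intro dvd_sum dvd_mult dvd_mult2) (auto intro: le_imp_power_dvd)
  ultimately show ?thesis by (simp add: cong_iff_dvd_diff)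
qed

text \<open>On a residue class of n modulo p - 1, the power sum over units depends on n only through
  binomial coefficients: the integers \<open>h j\<close> are chosen before n.\<close>

lemma sum_unit_power_expansion:
  assumes p: "prime p" and J: "0 < J" "J < p"
  obtains h :: "nat \<Rightarrow> int" where
    "\<And>n. [n = k] (mod (p - 1)) \<Longrightarrow>
      [(\<Sum>a=1..<p. \<Sum>b<p^s. int (a + p * b) ^ n) =
       int p ^ s * (\<Sum>a=1..<p. int a ^ (p ^ J * k)) +
       (\<Sum>j=1..<J. of_nat (n choose j) * (int p ^ (s + j) * h j))] (mod int p ^ J)"
proof -
  \<comment> \<open>Modulo p^J this is the Teichmueller representative: congruent to a modulo p by
    iterating Fermat, and a (p-1)-st root of unity modulo p^J.\<close>
  define W where "W = (\<lambda>a. int a ^ (p ^ J))"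
  have Wa: "[W a = int a] (mod int p)" if "a \<in> {1..<p}" for a
  proof -
    have "[int a ^ (p ^ i) = int a] (mod int p)" for i
    proof (induction i)
      case (Suc i)
      have "[(int a ^ (p ^ i)) ^ p = int a ^ p] (mod int p)" by (rule cong_pow[OF Suc])
      also have "int a ^ p = int a * int a ^ (p - 1)"
        using J power_eq_if[of "int a" p] by simp
      also have "[\<dots> = int a * 1] (mod int p)" by (intro cong_mult cong_refl fermat_int p that)
      finally show ?case by (simp add: mult.commute flip: power_mult)
    qed simp
    then show ?thesis by (simp add: W_def)
  qed
  have W1: "[W a ^ (p - 1) = 1] (mod int p ^ J)" if "a \<in> {1..<p}" for a
  proof -
    have "[(int a ^ (p - 1)) ^ (p ^ J) = 1 ^ (p ^ J)] (mod int p ^ Suc J)"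
      by (rule cong_power_prime_power[OF fermat_int[OF p that]])
    then have "[(int a ^ (p - 1)) ^ (p ^ J) = 1] (mod int p ^ J)"
      by (auto intro: cong_dvd_modulus)
    then show ?thesis by (simp add: W_def mult.commute flip: power_mult)
  qed
  \<comment> \<open>T inverts W a modulo p^J. As W a and a agree modulo p, the product a T has the
    form 1 + p q.\<close>
  have "\<exists>T q. [W a * T = 1] (mod int p ^ J) \<and> int a * T = 1 + int p * q" if a: "a \<in> {1..<p}" for a
  proof -
    have "coprime (W a) (int p ^ J)"
      using p a prime_imp_coprime[of p a] nat_dvd_not_less[of a p]
      by (auto simp: W_def coprime_commute coprime_power_left_iff coprime_power_right_iff)
    then obtain T where T: "[W a * T = 1] (mod int p ^ J)"
      using cong_solve_coprime_int by blast
    then have "[W a * T = 1] (mod int p)" by (rule cong_dvd_modulus) (use J in simp)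
    moreover have "[W a * T = int a * T] (mod int p)" by (intro cong_mult cong_refl Wa a)
    ultimately have "[int a * T = 1] (mod int p)" by (meson cong_sym cong_trans)
    then obtain q where "int a * T - 1 = int p * q" by (auto simp: cong_iff_dvd_diff)
    then show ?thesis using T by (intro exI[of _ T] exI[of _ q]) auto
  qed
  then obtain T q where T: "\<And>a. a \<in> {1..<p} \<Longrightarrow> [W a * T a = 1] (mod int p ^ J)"
    and q: "\<And>a. a \<in> {1..<p} \<Longrightarrow> int a * T a = 1 + int p * q a" by metis
  \<comment> \<open>The coefficient of (n choose j) p^j once a and b are summed out. It is divisible
    by p^s for j < J, since then j + 1 < p.\<close>
  define H where "H = (\<lambda>j. \<Sum>a=1..<p. W a ^ k * (\<Sum>b<p^s. (q a + int b * T a) ^ j))"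
  have Hdvd: "int p ^ s dvd H j" if "j < J" for j
    unfolding H_def using that J
    by (intro dvd_sum dvd_mult prime_power_dvd_sum_linear_power p) auto
  have unit: "[int (a + p * b) ^ n =
      (\<Sum>j<J. of_nat (n choose j) * (int p ^ j * (W a ^ k * (q a + int b * T a) ^ j)))] (mod int p ^ J)"
    if a: "a \<in> {1..<p}" and n: "[n = k] (mod (p - 1))" for a b n
  proof -
    have Wn: "[W a ^ n = W a ^ k] (mod int p ^ J)"
    proof -
      have red: "[W a ^ m = W a ^ (m mod (p - 1))] (mod int p ^ J)" for m
      proof -
        have "W a ^ m = (W a ^ (p - 1)) ^ (m div (p - 1)) * W a ^ (m mod (p - 1))"
          by (simp flip: power_mult power_add)
        also have "[\<dots> = 1 ^ (m div (p - 1)) * W a ^ (m mod (p - 1))] (mod int p ^ J)"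
          by (intro cong_mult cong_pow cong_refl W1 a)
        finally show ?thesis by simp
      qed
      have "n mod (p - 1) = k mod (p - 1)" using n by (simp add: cong_def)
      with red[of n] have "[W a ^ n = W a ^ (k mod (p - 1))] (mod int p ^ J)" by simp
      then show ?thesis using cong_sym[OF red[of k]] by (rule cong_trans)
    qed
    \<comment> \<open>Inserting (W T)^n = 1 splits the power into W^n, which may be replaced by W^k,
      and the n-th power of (a + p b) T = 1 + p (q + b T), which is expanded binomially.\<close>
    have "[int (a + p * b) ^ n * (W a * T a) ^ n = int (a + p * b) ^ n * 1 ^ n] (mod int p ^ J)"
      by (intro cong_mult cong_pow cong_refl T a)
    then have "[int (a + p * b) ^ n = W a ^ n * (int (a + p * b) * T a) ^ n] (mod int p ^ J)"
      by (simp add: power_mult_distrib mult_ac cong_sym_eq)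
    also have "int (a + p * b) * T a = 1 + int p * (q a + int b * T a)"
      using q[OF a] by (simp add: algebra_simps)
    also have "[W a ^ n * (1 + int p * (q a + int b * T a)) ^ n =
        W a ^ k * (\<Sum>j<J. of_nat (n choose j) * (int p ^ j * (q a + int b * T a) ^ j))] (mod int p ^ J)"
      by (intro cong_mult Wn binomial_expansion_cong)
    finally show ?thesis by (simp add: sum_distrib_left mult_ac)
  qed
  show ?thesis
  proof (rule that[of "\<lambda>j. H j div int p ^ s"])
    fix n assume n: "[n = k] (mod (p - 1))"
    have "[(\<Sum>a=1..<p. \<Sum>b<p^s. int (a + p * b) ^ n) =
      (\<Sum>a=1..<p. \<Sum>b<p^s. \<Sum>j<J. of_nat (n choose j) * (int p ^ j * (W a ^ k * (q a + int b * T a) ^ j)))] (mod int p ^ J)"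
      by (intro cong_sum unit n)
    also have "(\<Sum>a=1..<p. \<Sum>b<p^s. \<Sum>j<J. of_nat (n choose j) * (int p ^ j * (W a ^ k * (q a + int b * T a) ^ j))) =
        (\<Sum>a=1..<p. \<Sum>j<J. \<Sum>b<p^s. of_nat (n choose j) * (int p ^ j * (W a ^ k * (q a + int b * T a) ^ j)))"
      by (intro sum.cong refl sum.swap)
    also have "\<dots> = (\<Sum>j<J. \<Sum>a=1..<p. \<Sum>b<p^s. of_nat (n choose j) * (int p ^ j * (W a ^ k * (q a + int b * T a) ^ j)))"
      by (rule sum.swap)
    also have "\<dots> = (\<Sum>j<J. of_nat (n choose j) * (int p ^ j * H j))"
      by (simp add: H_def sum_distrib_left mult_ac)
    also have "{..<J} = insert 0 {1..<J}" using J by auto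
    also have "(\<Sum>j\<in>insert 0 {1..<J}. of_nat (n choose j) * (int p ^ j * H j)) =
        H 0 + (\<Sum>j=1..<J. of_nat (n choose j) * (int p ^ (s + j) * (H j div int p ^ s)))"
      using Hdvd by (subst sum.insert) (auto intro!: sum.cong simp: power_add dvd_mult_div_cancel mult_ac)
    \<comment> \<open>For j = 0 every inner summand is 1, so the sum over b is exactly p^s.\<close>
    also have "H 0 = int p ^ s * (\<Sum>a=1..<p. int a ^ (p ^ J * k))"
      unfolding H_def W_def sum_distrib_left by (intro sum.cong refl) (simp add: power_mult)
    finally show "[(\<Sum>a=1..<p. \<Sum>b<p^s. int (a + p * b) ^ n) =
       int p ^ s * (\<Sum>a=1..<p. int a ^ (p ^ J * k)) +
       (\<Sum>j=1..<J. of_nat (n choose j) * (int p ^ (s + j) * (H j div int p ^ s)))] (mod int p ^ J)" .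
  qed
qed

section \<open>Expansion of Bernoulli numbers in a residue class\<close>

text \<open>Every index below p^(s+1) is a + p b with a < p and b < p^s; the subtracted sum is the
  class a = 0.\<close>

lemma sum_split_residues:
  fixes g :: "nat \<Rightarrow> 'a :: ab_group_add"
  assumes "0 < p"
  shows "(\<Sum>a<p^Suc s. g a) - (\<Sum>b<p^s. g (p * b)) = (\<Sum>a=1..<p. \<Sum>b<p^s. g (a + p * b))"
proof -
  have split: "{..<p} = insert 0 {1..<p}" using assms by auto
  have "(\<Sum>a<p^Suc s. g a) = (\<Sum>b<p^s. sum g {b * p..<b * p + p})"
    by (simp add: sum.nat_group mult.commute)
  also have "\<dots> = (\<Sum>b<p^s. \<Sum>a<p. g (a + p * b))"
    using sum.shift_bounds_nat_ivl[of g 0 "_ * p" p]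
    by (simp add: atLeast0LessThan add.commute mult.commute)
  also have "\<dots> = (\<Sum>a<p. \<Sum>b<p^s. g (a + p * b))" by (rule sum.swap)
  also have "\<dots> = (\<Sum>b<p^s. g (p * b)) + (\<Sum>a=1..<p. \<Sum>b<p^s. g (a + p * b))"
    unfolding split by (subst sum.insert) auto
  finally show ?thesis by simp
qed

definition binomial_poly :: "nat \<Rightarrow> rat poly" where
  "binomial_poly j = smult (1 / fact j) (\<Prod>i<j. [:- of_nat i, 1:])"

lemma poly_binomial_poly: "poly (binomial_poly j) (of_nat n) = of_nat (n choose j)"
  by (simp add: binomial_poly_def poly_prod binomial_gbinomial gbinomial_prod_rev atLeast0LessThan)

lemma degree_binomial_poly_le: "degree (binomial_poly j) \<le> j"
  using degree_prod_sum_le[of "{..<j}" "\<lambda>i. [:- of_nat i, 1 :: rat:]"]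
  by (simp add: binomial_poly_def)

lemma coeff_binomial_poly_0: "j > 0 \<Longrightarrow> coeff (binomial_poly j) 0 = 0"
  using poly_binomial_poly[of j 0] by (simp add: poly_0_coeff_0)

text \<open>The product of linear factors has integer coefficients, and j! is prime to p because j <
  p.\<close>

lemma vp_ge_coeff_binomial_poly:
  assumes p: "prime p" and "j < p"
  shows "vp_ge p 0 (coeff (binomial_poly j) m)"
proof -
  have "\<not> int p dvd fact j"
    using assms prime_dvd_fact_iff[OF p, of j] by (metis int_dvd_int_iff not_le of_nat_fact)
  then have "vp_ge p 0 (1 / fact j)"
    using vp_ge_inverse_of_int[OF p, of "fact j"] by simp
  moreover have "vp_ge p 0 (coeff (\<Prod>i<j. [:- of_nat i, 1:]) m)" for m
  proof (induction j arbitrary: m)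
    case 0
    show ?case using vp_ge_of_nat[OF p, of 1] by (auto simp: p)
  next
    case (Suc j)
    have "vp_ge p (0 + 0) (of_nat j * coeff (\<Prod>i<j. [:- of_nat i, 1:]) m)"
      by (intro vp_ge_mult p vp_ge_of_nat Suc)
    then show ?case using Suc
      by (auto simp: mult.commute[of _ "pCons _ _"] coeff_pCons p intro!: vp_ge_add vp_ge_diff vp_ge_uminus split: nat.split)
  qed
  ultimately show ?thesis
    using vp_ge_mult[OF p, of 0 "1 / fact j" 0] by (simp add: binomial_poly_def)
qed

text \<open>Divide the expanded power sum over units by p^(s+1): the j = 0 term becomes the
  constant, the others a polynomial in n whose coefficients of n^m are divisible by p^(m-1), so that
  it may be cut off after degree K.\<close>

lemma bernoulli_padic_expansion:
  assumes p: "prime p" and K: "2 * K + 3 < p"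
  obtains e :: "nat \<Rightarrow> rat" where
    "\<And>m. vp_ge p (int m - 1) (e m)"
    "\<And>n. 0 < n \<Longrightarrow> [n = k] (mod (p - 1)) \<Longrightarrow>
       vp_ge p (int K) ((1 - of_nat p ^ (n - 1)) * bernoulli n -
         ((if (p - 1) dvd k then 1 - 1 / of_nat p else 0) + (\<Sum>m=1..K. e m * of_nat n ^ m)))"
proof -
  \<comment> \<open>The passage from power sums to B_n is accurate to p^(s-2) = p^K, and J = K + s +
    1 leaves accuracy p^K after division by p^(s+1).\<close>
  define s J where "s = K + 2" and "J = 2 * K + 3"
  have J: "0 < J" "J < p" and sJ: "J = K + Suc s" using K by (auto simp: J_def s_def)
  have p1: "p > 1" using p prime_gt_1_nat by blast
  note p0 = p_nonzero[OF p]
  define U where "U = (\<Sum>a=1..<p. int a ^ (p ^ J * k))"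
  obtain h where h: "\<And>n. [n = k] (mod (p - 1)) \<Longrightarrow>
      [(\<Sum>a=1..<p. \<Sum>b<p^s. int (a + p * b) ^ n) = int p ^ s * U +
       (\<Sum>j=1..<J. of_nat (n choose j) * (int p ^ (s + j) * h j))] (mod int p ^ J)"
    unfolding U_def by (rule sum_unit_power_expansion[OF p J, where k = k and s = s]) blast
  define Q where "Q = (\<Sum>j=1..<J. smult (of_nat p ^ (j - 1) * of_int (h j)) (binomial_poly j))"
  define u :: rat where "u = (if (p - 1) dvd k then 1 - 1 / of_nat p else 0)"
  \<comment> \<open>Only the terms with j \<ge> m reach the coefficient of n^m, and the j-th one
    carries p^(j-1).\<close>
  have coeffQ: "vp_ge p (int m - 1) (coeff Q m)" for m
    unfolding Q_def coeff_sum
  proof (intro vp_ge_sum p)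
    fix j assume j: "j \<in> {1..<J}"
    show "vp_ge p (int m - 1) (coeff (smult (of_nat p ^ (j - 1) * of_int (h j)) (binomial_poly j)) m)"
    proof (cases "m \<le> j")
      case True
      have "vp_ge p (int (j - 1) + 0 + 0) (of_nat p ^ (j - 1) * of_int (h j) * coeff (binomial_poly j) m)"
        using j J by (intro vp_ge_mult p vp_ge_p_power vp_ge_of_int vp_ge_coeff_binomial_poly) auto
      then show ?thesis using True j by (auto intro: vp_ge_mono[OF p])
    next
      case False
      then have "coeff (binomial_poly j) m = 0"
        using degree_binomial_poly_le[of j] by (intro coeff_eq_0) auto
      then show ?thesis by (simp add: p)
    qed
  qed
  have Q0: "coeff Q 0 = 0" by (simp add: Q_def coeff_sum coeff_binomial_poly_0)
  have polyQ: "poly Q (of_nat n) = (\<Sum>j=1..<J. of_nat p ^ (j - 1) * of_int (h j) * of_nat (n choose j))" for n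
    by (simp add: Q_def poly_sum poly_binomial_poly)
  have trunc: "vp_ge p (int K) (poly Q (of_nat n) - (\<Sum>m=1..K. coeff Q m * of_nat n ^ m))" for n
  proof -
    \<comment> \<open>Large enough to exceed both the degree of Q and K, so the coefficient sum can
      be split after K.\<close>
    define D where "D = degree Q + K"
    have "poly Q (of_nat n) = (\<Sum>m\<le>D. coeff Q m * of_nat n ^ m)"
      unfolding poly_altdef D_def by (rule sum.mono_neutral_left) (auto simp: coeff_eq_0)
    also have "{..D} = insert 0 ({1..K} \<union> {Suc K..D})" by (auto simp: D_def)
    also have "(\<Sum>m\<in>\<dots>. coeff Q m * of_nat n ^ m) =
        (\<Sum>m=1..K. coeff Q m * of_nat n ^ m) + (\<Sum>m=Suc K..D. coeff Q m * of_nat n ^ m)"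
      by (subst sum.insert) (auto simp: Q0 intro!: sum.union_disjoint)
    finally have "poly Q (of_nat n) - (\<Sum>m=1..K. coeff Q m * of_nat n ^ m) =
        (\<Sum>m=Suc K..D. coeff Q m * of_nat n ^ m)" by simp
    moreover have "vp_ge p (int K) \<dots>"
      by (intro vp_ge_sum p vp_ge_mult'[OF p coeffQ vp_ge_power[OF p vp_ge_of_nat[OF p]]]) auto
    ultimately show ?thesis by simp
  qed
  \<comment> \<open>If p - 1 divides k, Fermat and lifting make each summand of U equal to 1 modulo
    p^(J+1), so U is p - 1 there; otherwise U vanishes to that modulus.\<close>
  have Ucong: "vp_ge p (int K) (of_int U / of_nat p - u)"
  proof (cases "(p - 1) dvd k")
    case True
    then obtain c where c: "k = (p - 1) * c" by blast
    have "[U = (\<Sum>a=1..<p. 1 ^ c)] (mod int p ^ Suc J)"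
      unfolding U_def
    proof (rule cong_sum)
      fix a assume "a \<in> {1..<p}"
      then have "[((int a ^ (p - 1)) ^ p ^ J) ^ c = (1 ^ p ^ J) ^ c] (mod int p ^ Suc J)"
        by (intro cong_pow cong_power_prime_power fermat_int p)
      then show "[int a ^ (p ^ J * k) = 1 ^ c] (mod int p ^ Suc J)"
        by (simp add: c mult_ac flip: power_mult)
    qed
    then have "int p ^ Suc J dvd U - (int p - 1)"
      using p1 by (simp add: cong_iff_dvd_diff of_nat_diff)
    then have "vp_ge p (int (Suc J)) (of_int (U - (int p - 1)))"
      by (rule vp_ge_of_int_dvd[OF p])
    then have "vp_ge p (int J) (of_int (U - (int p - 1)) / of_nat p ^ 1)"
      by (intro vp_ge_divide_power p) (simp add: add.commute)
    moreover have "of_int (U - (int p - 1)) / of_nat p ^ 1 = of_int U / of_nat p - u"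
      using True p0 by (simp add: u_def field_simps)
    ultimately show ?thesis by (auto simp: sJ intro: vp_ge_mono[OF p])
  next
    case False
    then have "int p ^ Suc J dvd U"
      using cong_sum_power_residues_0[OF p False, of J] by (simp add: U_def cong_0_iff)
    then have "vp_ge p (int (Suc J)) (of_int U)"
      by (rule vp_ge_of_int_dvd[OF p])
    then have "vp_ge p (int J) (of_int U / of_nat p ^ 1)"
      by (intro vp_ge_divide_power p) (simp add: add.commute)
    then show ?thesis using False by (auto simp: u_def sJ intro: vp_ge_mono[OF p])
  qed
  show ?thesis
  proof (rule that[of "coeff Q"])
    fix n :: nat assume n: "0 < n" and nk: "[n = k] (mod (p - 1))"
    define S where "S = (\<Sum>a=1..<p. \<Sum>b<p^s. int (a + p * b) ^ n)"
    have S: "((\<Sum>a<p^Suc s. of_nat a ^ n) - (\<Sum>b<p^s. of_nat (p * b) ^ n)) = (of_int S :: rat)"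
      using p1 sum_split_residues[of p "\<lambda>a. of_nat a ^ n :: rat" s] by (simp add: S_def)
    have 1: "vp_ge p (int K) (of_int S / of_nat p ^ Suc s - (1 - of_nat p ^ (n - 1)) * bernoulli n)"
      using euler_factor_bernoulli_cong[OF p n, of s] unfolding S by (simp add: s_def)
    define S' where "S' = int p ^ s * U + (\<Sum>j=1..<J. of_nat (n choose j) * (int p ^ (s + j) * h j))"
    have "int p ^ J dvd S - S'"
      using h[OF nk] by (simp add: S_def S'_def cong_iff_dvd_diff)
    then have "vp_ge p (int J) (of_int (S - S'))" by (rule vp_ge_of_int_dvd[OF p])
    then have 2: "vp_ge p (int K) (of_int (S - S') / of_nat p ^ Suc s)"
      by (intro vp_ge_divide_power p) (simp add: sJ algebra_simps)
    have "of_nat (n choose j) * (of_nat p ^ (s + j) * of_int (h j)) / of_nat p ^ Suc s =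
        of_nat p ^ (j - 1) * of_int (h j) * (of_nat (n choose j) :: rat)" if "j \<in> {1..<J}" for j
      using that p0 by (cases j) (auto simp: power_add)
    then have "of_int S' / of_nat p ^ Suc s = of_int U / of_nat p + poly Q (of_nat n)"
      using p0 by (simp add: S'_def polyQ add_divide_distrib sum_divide_distrib)
    then have "of_int (S - S') / of_nat p ^ Suc s =
        of_int S / of_nat p ^ Suc s - of_int U / of_nat p - poly Q (of_nat n)"
      by (simp add: diff_divide_distrib)
    \<comment> \<open>Four errors, each divisible by p^K: the expansion modulo p^J, the passage from
      power sums to Bernoulli numbers, the constant term, and the cut-off of Q.\<close>
    then have eq: "(1 - of_nat p ^ (n - 1)) * bernoulli n - (u + (\<Sum>m=1..K. coeff Q m * of_nat n ^ m)) =
      of_int (S - S') / of_nat p ^ Suc s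
       - (of_int S / of_nat p ^ Suc s - (1 - of_nat p ^ (n - 1)) * bernoulli n)
       + (of_int U / of_nat p - u)
       + (poly Q (of_nat n) - (\<Sum>m=1..K. coeff Q m * of_nat n ^ m))"
      by simp
    show "vp_ge p (int K) ((1 - of_nat p ^ (n - 1)) * bernoulli n -
         ((if (p - 1) dvd k then 1 - 1 / of_nat p else 0) + (\<Sum>m=1..K. coeff Q m * of_nat n ^ m)))"
      unfolding u_def[symmetric] eq
      by (intro vp_ge_add vp_ge_diff p 1 2 Ucong trunc)
  qed (rule coeffQ)
qed

text \<open>For n \<ge> K + 2 the term p^(n-1) B_n has valuation at least K, so the Euler factor may
  be dropped. The version with the factor stays available, with the same coefficients, for
  comparison at the small index n = k.\<close>

lemma bernoulli_cong_poly:
  assumes p: "prime p" and K: "2 * K + 3 < p"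
  obtains e :: "nat \<Rightarrow> rat" where
    "\<And>m. vp_ge p (int m - 1) (e m)"
    "\<And>n. 0 < n \<Longrightarrow> [n = k] (mod (p - 1)) \<Longrightarrow>
       vp_ge p (int K) ((1 - of_nat p ^ (n - 1)) * bernoulli n -
         ((if (p - 1) dvd k then 1 - 1 / of_nat p else 0) + (\<Sum>m=1..K. e m * of_nat n ^ m)))"
    "\<And>n. K + 2 \<le> n \<Longrightarrow> [n = k] (mod (p - 1)) \<Longrightarrow>
       vp_ge p (int K) (bernoulli n -
         ((if (p - 1) dvd k then 1 - 1 / of_nat p else 0) + (\<Sum>m=1..K. e m * of_nat n ^ m)))"
proof -
  obtain e :: "nat \<Rightarrow> rat" where e: "\<And>m. vp_ge p (int m - 1) (e m)"
    and E: "\<And>n. 0 < n \<Longrightarrow> [n = k] (mod (p - 1)) \<Longrightarrow>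
       vp_ge p (int K) ((1 - of_nat p ^ (n - 1)) * bernoulli n -
         ((if (p - 1) dvd k then 1 - 1 / of_nat p else 0) + (\<Sum>m=1..K. e m * of_nat n ^ m)))"
    by (rule bernoulli_padic_expansion[OF assms, where k = k]) blast
  have "vp_ge p (int K) (bernoulli n -
         ((if (p - 1) dvd k then 1 - 1 / of_nat p else 0) + (\<Sum>m=1..K. e m * of_nat n ^ m)))"
    if n: "K + 2 \<le> n" "[n = k] (mod (p - 1))" for n
  proof -
    have "vp_ge p (int K) (of_nat p ^ (n - 1) * bernoulli n)"
      using n by (intro vp_ge_mult'[OF p vp_ge_p_power[OF p] vp_ge_bernoulli[OF p]]) auto
    moreover have "0 < n" using n by simp
    moreover have "(1 - q) * B - w + q * B = B - w" for q B w :: rat by (simp add: algebra_simps)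
    ultimately show ?thesis using vp_ge_add[OF p E[of n]] n(2) by metis
  qed
  with e E that show ?thesis by blast
qed

text \<open>The contribution of class k that remains modulo p^N after summation; its two nonzero
  branches are the summands of the first condition at t = p.\<close>

definition bernoulli_main_term :: "nat \<Rightarrow> int \<Rightarrow> rat \<Rightarrow> rat \<Rightarrow> rat" where
  "bernoulli_main_term p k G x =
     (if k = 0 then (1 - 1 / of_nat p) * G
      else if k \<ge> 2 then (1 - of_nat p ^ (nat k - 1)) * (bernoulli (nat k) / of_int k) * G * x
      else 0)"

text \<open>The bound m - 1 on e_m complements the bound N + 1 - m on the weighted power sums, so
  their products vanish modulo p^N. For even k > 0 the expansion at n = k replaces the unknown e_1
  by B_k / k, which leaves the differences x^m - k^(m-1) x.\<close>

lemma bernoulli_sum_cong: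
  fixes G :: "'i \<Rightarrow> rat" and x :: "'i \<Rightarrow> nat" and k :: int
  assumes p: "prime p" and K: "2 * K + 3 < p" and k: "\<bar>k\<bar> < int p - 1"
    and G: "\<And>i. i \<in> I \<Longrightarrow> vp_ge p M (G i)" and N: "N \<le> M + int K"
    and x: "\<And>i. i \<in> I \<Longrightarrow> K + 3 \<le> x i" "\<And>i. i \<in> I \<Longrightarrow> [int (x i) = k] (mod (int p - 1))"
    and nonpos: "\<And>m. even k \<Longrightarrow> k \<le> 0 \<Longrightarrow> m \<in> {1..K} \<Longrightarrow>
      vp_ge p (N + 1 - int m) (\<Sum>i\<in>I. G i * of_nat (x i) ^ m)"
    and pos: "\<And>m. even k \<Longrightarrow> k > 0 \<Longrightarrow> m \<in> {2..K} \<Longrightarrow>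
      vp_ge p (N + 1 - int m) (\<Sum>i\<in>I. G i * (of_nat (x i) ^ m - of_int (k ^ (m - 1)) * of_nat (x i)))"
  shows "vp_ge p N (\<Sum>i\<in>I. G i * bernoulli (x i) - bernoulli_main_term p k (G i) (of_nat (x i)))"
proof -
  have p1: "p > 3" using K by simp
  have xk: "[x i = c] (mod (p - 1))" if "i \<in> I" "[int c = k] (mod (int p - 1))" for i c
  proof -
    have "[int (x i) = int c] (mod (int p - 1))"
      using x(2)[OF that(1)] cong_sym[OF that(2)] by (rule cong_trans)
    moreover have "int p - 1 = int (p - 1)" using p1 by simp
    ultimately show ?thesis by (simp only: cong_int_iff)
  qed
  consider "odd k" | "even k" "k \<le> 0" | "even k" "k > 0" by linarith
  then show ?thesis
  proof cases
    case 1
    \<comment> \<open>Since p - 1 is even, x i is odd like k, and x i \<ge> 3 excludes the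
      exceptional B_1.\<close>
    have "even (int p - 1)"
      using prime_odd_nat[OF p] p1 by simp
    have "bernoulli (x i) = 0" if i: "i \<in> I" for i
    proof -
      have "[int (x i) = k] (mod 2)"
        using x(2)[OF i] \<open>even (int p - 1)\<close> by (rule cong_dvd_modulus)
      then have "odd (x i)" using 1 by (simp add: cong_iff_dvd_diff)
      then show ?thesis using x(1)[OF i] by (intro bernoulli_odd_eq_0) auto
    qed
    moreover have "bernoulli_main_term p k a b = 0" for a b
      using 1 by (auto simp: bernoulli_main_term_def even_nat_iff intro!: bernoulli_odd_eq_0)
    ultimately show ?thesis using p by simp
  next
    case 2
    \<comment> \<open>A natural representative of k modulo p - 1. For k < 0 it lies strictly between
      0 and p - 1, so p - 1 divides it only when k = 0.\<close>
    define c where "c = (if k = 0 then 0 else nat (k + (int p - 1)))"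
    have c: "[int c = k] (mod (int p - 1))"
      using k by (auto simp: c_def cong_iff_dvd_diff)
    have dvd: "(p - 1) dvd c \<longleftrightarrow> k = 0"
      using k 2 p1 by (auto simp: c_def dest!: dvd_imp_le)
    obtain e :: "nat \<Rightarrow> rat" where e: "\<And>m. vp_ge p (int m - 1) (e m)"
      and E: "\<And>n. K + 2 \<le> n \<Longrightarrow> [n = c] (mod (p - 1)) \<Longrightarrow>
       vp_ge p (int K) (bernoulli n -
         ((if (p - 1) dvd c then 1 - 1 / of_nat p else 0) + (\<Sum>m=1..K. e m * of_nat n ^ m)))"
      by (rule bernoulli_cong_poly[OF p K, where k = c]) blast
    define u :: rat where "u = (if (p - 1) dvd c then 1 - 1 / of_nat p else 0)"
    define err where "err = (\<lambda>i. bernoulli (x i) - (u + (\<Sum>m=1..K. e m * of_nat (x i) ^ m)))"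
    have "vp_ge p N (G i * err i)" if "i \<in> I" for i
      unfolding err_def u_def using x(1)[OF that]
      by (intro vp_ge_mult'[OF p G[OF that] E[OF _ xk[OF that c]] N]) simp
    then have 1: "vp_ge p N (\<Sum>i\<in>I. G i * err i)" by (intro vp_ge_sum p)
    have 2: "vp_ge p N (\<Sum>m=1..K. e m * (\<Sum>i\<in>I. G i * of_nat (x i) ^ m))"
      by (intro vp_ge_sum p vp_ge_mult'[OF p e nonpos[OF 2]]) auto
    have "bernoulli_main_term p k (G i) (of_nat (x i)) = u * G i" for i
      using \<open>k \<le> 0\<close> dvd by (simp add: bernoulli_main_term_def u_def)
    then have "(\<Sum>i\<in>I. G i * bernoulli (x i) - bernoulli_main_term p k (G i) (of_nat (x i)))
        = (\<Sum>i\<in>I. G i * err i + (\<Sum>m=1..K. e m * (G i * of_nat (x i) ^ m)))"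
      by (intro sum.cong refl) (simp add: err_def algebra_simps sum_distrib_left)
    also have "\<dots> = (\<Sum>i\<in>I. G i * err i) + (\<Sum>m=1..K. e m * (\<Sum>i\<in>I. G i * of_nat (x i) ^ m))"
      by (simp add: sum.distrib sum_distrib_left sum.swap[of _ I])
    finally show ?thesis using vp_ge_add[OF p 1 2] by simp
  next
    case 3
    define c where "c = nat k"
    have c: "[int c = k] (mod (int p - 1))" "0 < c" "k = int c"
      using 3 by (auto simp: c_def)
    have ndvd: "\<not> (p - 1) dvd c" using k c by (auto dest!: dvd_imp_le)
    obtain e :: "nat \<Rightarrow> rat" where e: "\<And>m. vp_ge p (int m - 1) (e m)"
      and E0: "\<And>n. 0 < n \<Longrightarrow> [n = c] (mod (p - 1)) \<Longrightarrow>
       vp_ge p (int K) ((1 - of_nat p ^ (n - 1)) * bernoulli n -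
         ((if (p - 1) dvd c then 1 - 1 / of_nat p else 0) + (\<Sum>m=1..K. e m * of_nat n ^ m)))"
      and E: "\<And>n. K + 2 \<le> n \<Longrightarrow> [n = c] (mod (p - 1)) \<Longrightarrow>
       vp_ge p (int K) (bernoulli n -
         ((if (p - 1) dvd c then 1 - 1 / of_nat p else 0) + (\<Sum>m=1..K. e m * of_nat n ^ m)))"
      by (rule bernoulli_cong_poly[OF p K, where k = c]) blast
    define err where "err = (\<lambda>i. bernoulli (x i) - (\<Sum>m=1..K. e m * of_nat (x i) ^ m))"
    \<comment> \<open>The expansion error at n = k itself; its constant term is 0 because 0 < k < p
      - 1.\<close>
    define err0 where "err0 = (1 - of_nat p ^ (c - 1)) * bernoulli c - (\<Sum>m=1..K. e m * of_nat c ^ m)"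
    have err0: "vp_ge p (int K) err0" using E0[OF c(2) cong_refl] ndvd by (simp add: err0_def)
    have ck: "vp_ge p 0 (1 / of_int k)"
      using k c nat_dvd_not_less[of c p] by (intro vp_ge_inverse_of_int p) auto
    have "vp_ge p N (G i * err i)" if "i \<in> I" for i
    proof -
      have "vp_ge p (int K) (err i)"
        using E[OF _ xk[OF that c(1)]] x(1)[OF that] ndvd by (simp add: err_def)
      then show ?thesis by (rule vp_ge_mult'[OF p G[OF that] _ N])
    qed
    then have 1: "vp_ge p N (\<Sum>i\<in>I. G i * err i)" by (intro vp_ge_sum p)
    have bound: "vp_ge p (int K + 0 + (M + 0)) (err0 * (1 / of_int k) * (G i * of_nat (x i)))" if "i \<in> I" for i
      using that by (intro vp_ge_mult p err0 ck G vp_ge_of_nat)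
    have 2: "vp_ge p N (\<Sum>i\<in>I. err0 * (1 / of_int k) * (G i * of_nat (x i)))"
      using N by (intro vp_ge_sum p vp_ge_mono[OF p bound]) auto
    have 3: "vp_ge p N (\<Sum>m=1..K. e m * (\<Sum>i\<in>I. G i * (of_nat (x i) ^ m - of_int (k ^ (m - 1)) * of_nat (x i))))"
    proof (intro vp_ge_sum p)
      fix m assume m: "m \<in> {1..K}"
      show "vp_ge p N (e m * (\<Sum>i\<in>I. G i * (of_nat (x i) ^ m - of_int (k ^ (m - 1)) * of_nat (x i))))"
      \<comment> \<open>For m = 1 the difference is x - k^0 x = 0, which is why bounds are only
        required from m = 2 on.\<close>
      proof (cases "m = 1")
        case True
        then show ?thesis using p by simp
      next
        case False
        then show ?thesis using m by (intro vp_ge_mult'[OF p e pos[OF 3]]) auto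
      qed
    qed
    have main: "bernoulli_main_term p k (G i) (of_nat (x i)) =
        err0 * (1 / of_int k) * (G i * of_nat (x i)) + (\<Sum>m=1..K. e m * (G i * (of_int (k ^ (m - 1)) * of_nat (x i))))" for i
    proof -
      have "k \<ge> 2" using \<open>even k\<close> \<open>k > 0\<close> by presburger
      \<comment> \<open>Pulling out one factor k lets the expansion at n = k be divided by k, which
        yields B_k / k and the powers k^(m-1).\<close>
      have "(\<Sum>m=1..K. e m * of_nat c ^ m) = of_int k * (\<Sum>m=1..K. e m * of_int (k ^ (m - 1)))"
        unfolding sum_distrib_left
      proof (intro sum.cong refl)
        fix m assume "m \<in> {1..K}"
        then show "e m * of_nat c ^ m = of_int k * (e m * of_int (k ^ (m - 1)))"
          by (cases m) (auto simp: c(3))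
      qed
      then have "(1 - of_nat p ^ (c - 1)) * bernoulli c = err0 + of_int k * (\<Sum>m=1..K. e m * of_int (k ^ (m - 1)))"
        by (simp add: err0_def)
      then have "(1 - of_nat p ^ (c - 1)) * bernoulli c / of_int k =
          err0 * (1 / of_int k) + (\<Sum>m=1..K. e m * of_int (k ^ (m - 1)))"
        using c by (simp add: add_divide_distrib)
      moreover have "bernoulli_main_term p k (G i) (of_nat (x i)) =
          (1 - of_nat p ^ (c - 1)) * bernoulli c / of_int k * (G i * of_nat (x i))"
        using \<open>k \<ge> 2\<close> by (simp add: bernoulli_main_term_def c_def)
      ultimately show ?thesis by (simp add: algebra_simps sum_distrib_left)
    qed
    have "(\<Sum>i\<in>I. G i * bernoulli (x i) - bernoulli_main_term p k (G i) (of_nat (x i)))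
        = (\<Sum>i\<in>I. G i * err i - err0 * (1 / of_int k) * (G i * of_nat (x i)) +
           (\<Sum>m=1..K. e m * (G i * (of_nat (x i) ^ m - of_int (k ^ (m - 1)) * of_nat (x i)))))"
      unfolding main
      by (intro sum.cong refl) (simp add: err_def algebra_simps sum_distrib_left sum_subtractf)
    also have "\<dots> = (\<Sum>i\<in>I. G i * err i) - (\<Sum>i\<in>I. err0 * (1 / of_int k) * (G i * of_nat (x i))) +
        (\<Sum>m=1..K. e m * (\<Sum>i\<in>I. G i * (of_nat (x i) ^ m - of_int (k ^ (m - 1)) * of_nat (x i))))"
      by (simp add: sum.distrib sum_subtractf sum_distrib_left sum.swap[of _ I])
    finally show ?thesis using vp_ge_add[OF p vp_ge_diff[OF p 1 2] 3] by simp
  qed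
qed

section \<open>Specialising rational functions at large primes\<close>

text \<open>Used twice: f(p) = f(1) modulo p - 1 fixes the residue class of the Bernoulli index, and
  Q(p) = Q(0) modulo p detects p-adic units.\<close>

lemma dvd_poly_diff:
  fixes q :: "int poly"
  shows "x - y dvd poly q x - poly q y"
proof (induction q)
  case (pCons a q)
  have "poly (pCons a q) x - poly (pCons a q) y = (x - y) * poly q x + y * (poly q x - poly q y)"
    by (simp add: algebra_simps)
  then show ?case using pCons by simp
qed simp

lemma poly_map_poly_rat_of_int:
  "poly (map_poly rat_of_int q) (of_int x) = of_int (poly q x)"
  by (induction q) (simp_all add: map_poly_pCons)

lemma rat_poly_clear_denominators:
  fixes q :: "rat poly"
  obtains D :: int and Q :: "int poly" where "D \<noteq> 0" "smult (of_int D) q = map_poly rat_of_int Q"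
proof (induction q arbitrary: thesis)
  case 0
  show ?case by (rule 0[of 1 0]) auto
next
  case (pCons a q)
  obtain D Q where DQ: "D \<noteq> 0" "smult (of_int D) q = map_poly rat_of_int Q"
    using pCons.IH by blast
  obtain r s where rs: "quotient_of a = (r, s)" by fastforce
  have s: "s > 0" "a = of_int r / of_int s"
    using quotient_of_denom_pos[OF rs] quotient_of_div[OF rs] by auto
  have "smult (of_int (s * D)) (pCons a q) = pCons (of_int (r * D)) (smult (of_int s) (smult (of_int D) q))"
    using s by simp
  also have "\<dots> = map_poly rat_of_int (pCons (r * D) (smult s Q))"
    by (simp add: DQ(2) map_poly_pCons map_poly_smult)
  finally show ?case using pCons.prems[of "s * D"] s DQ by auto
qed

lemma eventually_poly_nonzero:
  fixes q :: "rat poly"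
  assumes "q \<noteq> 0"
  shows "\<forall>\<^sub>F p in sequentially. poly q (of_nat p) \<noteq> 0"
proof -
  have "finite ((of_nat :: nat \<Rightarrow> rat) -` {x. poly q x = 0})"
    by (intro finite_vimageI poly_roots_finite assms inj_of_nat)
  then show ?thesis
    by (simp add: eventually_cofinite vimage_def flip: cofinite_eq_sequentially)
qed

text \<open>With D q = Q integral, a prime above |D| + |Q(0)| divides neither number, and Q(p) =
  Q(0) modulo p.\<close>

lemma eventually_poly_padic_unit:
  fixes q :: "rat poly"
  assumes "poly q 0 \<noteq> 0"
  shows "\<forall>\<^sub>F p in sequentially. prime p \<longrightarrow>
    (\<exists>c d. \<not> int p dvd c \<and> \<not> int p dvd d \<and> poly q (of_nat p) = of_int c / of_int d)"
proof -
  obtain D Q where DQ: "D \<noteq> 0" "smult (of_int D) q = map_poly rat_of_int Q"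
    by (rule rat_poly_clear_denominators)
  have Q: "of_int D * poly q (of_int x) = of_int (poly Q x)" for x
    by (metis DQ(2) poly_map_poly_rat_of_int poly_smult)
  have Q0: "poly Q 0 \<noteq> 0" using Q[of 0] assms DQ(1) by auto
  have "\<forall>\<^sub>F p in sequentially. nat (\<bar>D\<bar> + \<bar>poly Q 0\<bar>) < p" by (rule eventually_gt_at_top)
  then show ?thesis
  proof eventually_elim
    case (elim p)
    have "\<not> int p dvd D" "\<not> int p dvd poly Q 0"
      using elim DQ(1) Q0 by (auto dest!: dvd_imp_le_int)
    moreover have "int p dvd poly Q (int p) - poly Q 0"
      using dvd_poly_diff[of "int p" 0 Q] by simp
    ultimately have "\<not> int p dvd poly Q (int p)"
      by (meson dvd_diff_right_iff dvd_diff_left_iff)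
    moreover have "poly q (of_nat p) = of_int (poly Q (int p)) / of_int D"
      using Q[of "int p"] DQ(1) by (simp add: field_simps)
    ultimately show ?case using \<open>\<not> int p dvd D\<close> by blast
  qed
qed

text \<open>Pointwise \<open>rf_eval\<close> need not respect sums and products at poles. Asking for
  equality at all large p avoids the finitely many poles and makes evaluation compatible with the
  field operations used.\<close>

definition rf_evals_to :: "rat poly fract \<Rightarrow> (nat \<Rightarrow> rat) \<Rightarrow> bool" where
  "rf_evals_to g \<phi> \<longleftrightarrow> (\<forall>\<^sub>F p in sequentially. rf_eval g (of_nat p) = \<phi> p)"

text \<open>Any representing fraction may be used: cross-multiply with the reduced one and avoid the
  finitely many roots of both denominators.\<close>

lemma rf_evals_to_divide:
  assumes "b \<noteq> 0"
  shows "rf_evals_to (to_fract a / to_fract b) (\<lambda>p. poly a (of_nat p) / poly b (of_nat p))"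
proof -
  define g where "g = to_fract a / to_fract b"
  define c d where "c = fst (quot_of_fract g)" and "d = snd (quot_of_fract g)"
  have d: "d \<noteq> 0" by (simp add: d_def)
  have "to_fract c / to_fract d = to_fract a / to_fract b"
    unfolding c_def d_def Fract_conv_to_fract[symmetric] Fract_quot_of_fract
    by (simp add: g_def Fract_conv_to_fract)
  then have "to_fract (c * b) = to_fract (a * d)"
    using assms d by (simp add: field_simps)
  then have eq: "c * b = a * d" by (simp only: to_fract_eq_iff)
  from eventually_poly_nonzero[OF assms] eventually_poly_nonzero[OF d] show ?thesis
    unfolding rf_evals_to_def g_def[symmetric]
  proof eventually_elim
    case (elim p)
    have "poly c (of_nat p) * poly b (of_nat p) = poly a (of_nat p) * poly d (of_nat p)"
      using arg_cong[OF eq, of "\<lambda>q. poly q (of_nat p)"] by simp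
    then show ?case using elim by (simp add: rf_eval_def field_simps flip: c_def d_def)
  qed
qed

lemma rf_evals_to_self: "rf_evals_to g (\<lambda>p. rf_eval g (of_nat p))"
  by (simp add: rf_evals_to_def)

lemma rf_evals_to_to_fract: "rf_evals_to (to_fract a) (\<lambda>p. poly a (of_nat p))"
  by (simp add: rf_evals_to_def rf_eval_def)

lemma fract_eq_to_fract_divide:
  obtains a b :: "rat poly" where "b \<noteq> 0" "g = to_fract a / to_fract b"
  using that[of "snd (quot_of_fract g)" "fst (quot_of_fract g)"] by (simp flip: Fract_conv_to_fract)

lemma rf_evals_to_trans:
  assumes "rf_evals_to g \<phi>" "\<forall>\<^sub>F p in sequentially. \<phi> p = \<psi> p"
  shows "rf_evals_to g \<psi>"
  using assms unfolding rf_evals_to_def by eventually_elim simp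

lemma rf_evals_to_add:
  assumes "rf_evals_to g \<phi>" "rf_evals_to h \<psi>"
  shows "rf_evals_to (g + h) (\<lambda>p. \<phi> p + \<psi> p)"
proof -
  obtain a b where ab: "b \<noteq> 0" "g = to_fract a / to_fract b" by (rule fract_eq_to_fract_divide)
  obtain c d where cd: "d \<noteq> 0" "h = to_fract c / to_fract d" by (rule fract_eq_to_fract_divide)
  have "g + h = to_fract (a * d + c * b) / to_fract (b * d)"
    using ab cd by (simp add: field_simps)
  then have "rf_evals_to (g + h) (\<lambda>p. poly (a * d + c * b) (of_nat p) / poly (b * d) (of_nat p))"
    using rf_evals_to_divide[of "b * d" "a * d + c * b"] ab cd by simp
  then show ?thesis
  proof (rule rf_evals_to_trans)
    show "\<forall>\<^sub>F p in sequentially.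
        poly (a * d + c * b) (of_nat p) / poly (b * d) (of_nat p) = \<phi> p + \<psi> p"
      using eventually_poly_nonzero[OF ab(1)] eventually_poly_nonzero[OF cd(1)]
        assms[unfolded rf_evals_to_def]
        rf_evals_to_divide[OF ab(1), of a, folded ab(2), unfolded rf_evals_to_def]
        rf_evals_to_divide[OF cd(1), of c, folded cd(2), unfolded rf_evals_to_def]
      by eventually_elim (simp add: field_simps)
  qed
qed

lemma rf_evals_to_mult:
  assumes "rf_evals_to g \<phi>" "rf_evals_to h \<psi>"
  shows "rf_evals_to (g * h) (\<lambda>p. \<phi> p * \<psi> p)"
proof -
  obtain a b where ab: "b \<noteq> 0" "g = to_fract a / to_fract b" by (rule fract_eq_to_fract_divide)
  obtain c d where cd: "d \<noteq> 0" "h = to_fract c / to_fract d" by (rule fract_eq_to_fract_divide)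
  have "g * h = to_fract (a * c) / to_fract (b * d)"
    using ab cd by simp
  then have "rf_evals_to (g * h) (\<lambda>p. poly (a * c) (of_nat p) / poly (b * d) (of_nat p))"
    using rf_evals_to_divide[of "b * d" "a * c"] ab cd by simp
  then show ?thesis
  proof (rule rf_evals_to_trans)
    show "\<forall>\<^sub>F p in sequentially. poly (a * c) (of_nat p) / poly (b * d) (of_nat p) = \<phi> p * \<psi> p"
      using assms[unfolded rf_evals_to_def]
        rf_evals_to_divide[OF ab(1), of a, folded ab(2), unfolded rf_evals_to_def]
        rf_evals_to_divide[OF cd(1), of c, folded cd(2), unfolded rf_evals_to_def]
      by eventually_elim (simp flip: times_divide_times_eq)
  qed
qed

lemma rf_evals_to_const: "rf_evals_to (rf_const c) (\<lambda>p. c)"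
  using rf_evals_to_to_fract[of "[:c:]"] by (simp add: rf_const_def)

lemma rf_evals_to_1: "rf_evals_to 1 (\<lambda>p. 1)"
  using rf_evals_to_to_fract[of 1] by simp

lemma rf_evals_to_0: "rf_evals_to 0 (\<lambda>p. 0)"
  using rf_evals_to_to_fract[of 0] by simp

lemma rf_evals_to_t: "rf_evals_to rf_t of_nat"
  using rf_evals_to_to_fract[of "[:0, 1:]"] by (simp add: rf_t_def)

lemma rf_evals_to_inverse_t: "rf_evals_to (1 / rf_t) (\<lambda>p. 1 / of_nat p)"
  using rf_evals_to_divide[of "[:0, 1:]" 1] by (simp add: rf_t_def)

lemma rf_evals_to_int_poly: "rf_evals_to (rf_of_int_poly q) (\<lambda>p. of_int (poly q (int p)))"
  using rf_evals_to_to_fract[of "map_poly rat_of_int q"] poly_map_poly_rat_of_int[of q "int _"]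
  by (simp add: rf_of_int_poly_def)

lemma rf_evals_to_diff:
  assumes "rf_evals_to g \<phi>" "rf_evals_to h \<psi>"
  shows "rf_evals_to (g - h) (\<lambda>p. \<phi> p - \<psi> p)"
proof -
  have "rf_evals_to (to_fract (- 1)) (\<lambda>p. - 1)" using rf_evals_to_to_fract[of "- 1"] by simp
  from rf_evals_to_add[OF assms(1) rf_evals_to_mult[OF this assms(2)]] show ?thesis by simp
qed

lemma rf_evals_to_power:
  assumes "rf_evals_to g \<phi>"
  shows "rf_evals_to (g ^ m) (\<lambda>p. \<phi> p ^ m)"
  by (induction m) (auto intro: rf_evals_to_1 rf_evals_to_mult assms)

lemma rf_evals_to_sum:
  assumes "\<And>i. i \<in> A \<Longrightarrow> rf_evals_to (g i) (\<phi> i)"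
  shows "rf_evals_to (\<Sum>i\<in>A. g i) (\<lambda>p. \<Sum>i\<in>A. \<phi> i p)"
  using assms
  by (induction A rule: infinite_finite_induct) (auto intro: rf_evals_to_0 rf_evals_to_add)

section \<open>From t-adic valuations to p-adic valuations at large primes, and growth of integer
  polynomials\<close>

lemma rat_poly_order_decomp:
  fixes q :: "rat poly"
  assumes "q \<noteq> 0"
  obtains r where "poly r 0 \<noteq> 0" "\<And>x. poly q x = x ^ order 0 q * poly r x"
proof -
  obtain r where r: "q = [:-0, 1:] ^ order 0 q * r" "\<not> [:-0, 1:] dvd r"
    using order_decomp[OF assms, of 0] by blast
  have "poly q x = x ^ order 0 q * poly r x" for x
    by (subst r(1)) (simp add: poly_power)
  moreover have "poly r 0 \<noteq> 0" using r(2) by (simp add: poly_eq_0_iff_dvd)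
  ultimately show ?thesis using that by blast
qed

text \<open>Split off the powers of t from numerator and denominator. The cofactors do not vanish at
  0, hence take p-adic unit values at large p, and only the power of p remains.\<close>

lemma eventually_vp_ge_rf_eval:
  assumes "v_t h \<ge> ereal (of_int e)"
  shows "\<forall>\<^sub>F p in sequentially. prime p \<longrightarrow> vp_ge p e (rf_eval h (of_nat p))"
proof (cases "h = 0")
  case True
  then show ?thesis by (simp add: rf_eval_def)
next
  case False
  define a b where "a = fst (quot_of_fract h)" and "b = snd (quot_of_fract h)"
  have "a \<noteq> 0" "b \<noteq> 0" using False by (auto simp: a_def b_def)
  obtain a' where a': "poly a' 0 \<noteq> 0" "\<And>x. poly a x = x ^ order 0 a * poly a' x"
    by (rule rat_poly_order_decomp[OF \<open>a \<noteq> 0\<close>]) blast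
  obtain b' where b': "poly b' 0 \<noteq> 0" "\<And>x. poly b x = x ^ order 0 b * poly b' x"
    by (rule rat_poly_order_decomp[OF \<open>b \<noteq> 0\<close>]) blast
  have e: "e \<le> int (order 0 a) - int (order 0 b)"
    using assms False by (simp add: v_t_def a_def b_def)
  show ?thesis
    using eventually_poly_padic_unit[OF a'(1)] eventually_poly_padic_unit[OF b'(1)]
  proof eventually_elim
    case (elim p)
    show ?case
    proof
      assume p: "prime p"
      obtain c d where cd: "\<not> int p dvd c" "\<not> int p dvd d" "poly a' (of_nat p) = of_int c / of_int d"
        using elim(1) p by blast
      obtain c' d' where cd': "\<not> int p dvd c'" "\<not> int p dvd d'" "poly b' (of_nat p) = of_int c' / of_int d'"
        using elim(2) p by blast
      have "rf_eval h (of_nat p) = of_int (c * d') / of_int (d * c') *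
          of_nat p powi (int (order 0 a) - int (order 0 b))"
        using p_nonzero[OF p] 
        by (simp add: rf_eval_def power_int_diff a'(2) b'(2) cd cd' mult_ac flip: a_def b_def)
      moreover have "\<not> int p dvd d * c'"
        using cd cd' prime_int_p[OF p] by (simp add: prime_dvd_mult_iff)
      ultimately have "vp_ge p (int (order 0 a) - int (order 0 b)) (rf_eval h (of_nat p))"
        by (intro vp_geI[of p "d * c'"])
      then show "vp_ge p e (rf_eval h (of_nat p))" using e by (rule vp_ge_mono[OF p])
    qed
  qed
qed

lemma eventually_vp_ge_rf_evals_to:
  assumes "v_t h \<ge> ereal (of_int e)" "rf_evals_to h \<phi>"
  shows "\<forall>\<^sub>F p in sequentially. prime p \<longrightarrow> vp_ge p e (\<phi> p)"
  using eventually_vp_ge_rf_eval[OF assms(1)] assms(2)[unfolded rf_evals_to_def]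
  by eventually_elim simp

text \<open>By Horner's scheme: the inner polynomial is eventually at least 1, so p times it plus a
  is at least p - |a|.\<close>

lemma eventually_int_poly_ge:
  fixes q :: "int poly"
  assumes "degree q > 0" "lead_coeff q > 0"
  shows "\<forall>\<^sub>F p in sequentially. poly q (int p) \<ge> c"
  using assms
proof (induction q arbitrary: c)
  case (pCons a q)
  have "q \<noteq> 0" using pCons.prems by (cases "q = 0") auto
  then have lc: "lead_coeff q > 0" using pCons.prems by simp
  have "\<forall>\<^sub>F p in sequentially. poly q (int p) \<ge> 1"
  proof (cases "degree q = 0")
    case True
    then obtain b where "q = [:b:]" by (rule degree_eq_zeroE)
    then show ?thesis using lc by simp
  next
    case False
    then show ?thesis using pCons.IH lc by simp
  qed
  moreover have "\<forall>\<^sub>F p in sequentially. nat (\<bar>c\<bar> + \<bar>a\<bar>) < p" by (rule eventually_gt_at_top)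
  ultimately show ?case
  proof eventually_elim
    case (elim p)
    have "int p * 1 \<le> int p * poly q (int p)" using elim by (intro mult_left_mono) auto
    moreover have "\<bar>c\<bar> + \<bar>a\<bar> < int p" using elim(2) by linarith
    ultimately show ?case by simp
  qed
qed simp

section \<open>Transfer of the conditions to large primes and summation over the residue classes
  f_i(1)\<close>

theorem theorem1:
  fixes N :: int and n :: nat
    and f :: "nat \<Rightarrow> int poly" and g :: "nat \<Rightarrow> rat poly fract"
    and M :: ereal
  assumes nonconst: "\<And>i. i \<in> {1..n} \<Longrightarrow> degree (f i) > 0"
    and lead_pos: "\<And>i. i \<in> {1..n} \<Longrightarrow> lead_coeff (f i) > 0"
    and M_def: "M = (MIN i\<in>{0..n}. v_t (g i))"
    and cond1: "v_t (g 0
        - (1 - 1 / rf_t) * (\<Sum>i | i \<in> {1..n} \<and> poly (f i) 1 = 0. g i)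
        - (\<Sum>i | i \<in> {1..n} \<and> poly (f i) 1 \<ge> 2.
             (1 - rf_t ^ (nat (poly (f i) 1) - 1))
             * rf_const (bernoulli (nat (poly (f i) 1)) / of_int (poly (f i) 1))
             * g i * rf_of_int_poly (f i))) \<ge> ereal (of_int N)"
    and cond2: "\<And>k m. k \<in> (\<lambda>i. poly (f i) 1) ` {1..n} \<Longrightarrow> even k \<Longrightarrow> k \<le> 0 \<Longrightarrow>
        1 \<le> m \<Longrightarrow> ereal (of_int m) \<le> ereal (of_int N) - M \<Longrightarrow>
        v_t (\<Sum>i | i \<in> {1..n} \<and> poly (f i) 1 = k. g i * rf_of_int_poly (f i) ^ nat m)
          \<ge> ereal (of_int (N + 1 - m))"
    and cond3: "\<And>k m. k \<in> (\<lambda>i. poly (f i) 1) ` {1..n} \<Longrightarrow> even k \<Longrightarrow> k > 0 \<Longrightarrow>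
        2 \<le> m \<Longrightarrow> ereal (of_int m) \<le> ereal (of_int N) - M \<Longrightarrow>
        v_t (\<Sum>i | i \<in> {1..n} \<and> poly (f i) 1 = k.
               g i * (rf_of_int_poly (f i) ^ nat m
                      - rf_const (of_int (k ^ nat (m - 1))) * rf_of_int_poly (f i)))
          \<ge> ereal (of_int (N + 1 - m))"
  shows "\<exists>P. \<forall>p. prime p \<and> p > P \<longrightarrow>
           cong_padic (\<Sum>i = 1..n. rf_eval (g i) (of_nat p) * bernoulli (nat (poly (f i) (int p))))
                      (rf_eval (g 0) (of_nat p)) p N"
proof -
  define ks where "ks = (\<lambda>i. poly (f i) 1) ` {1..n}"
  have "M \<in> (\<lambda>i. v_t (g i)) ` {0..n}" unfolding M_def by (rule Min_in) auto
  then obtain j where j: "M = v_t (g j)" by blast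
  have M_le: "M \<le> v_t (g i)" if "i \<in> {1..n}" for i
    unfolding M_def using that by (intro Min_le) auto
  \<comment> \<open>M0 is the integer value of M when M is finite. If M is infinite, M0 = N leaves
    no m with 1 \<le> m \<le> N - M0.\<close>
  obtain M0 :: int where M0_le: "\<And>i. i \<in> {1..n} \<Longrightarrow> ereal (of_int M0) \<le> v_t (g i)"
    and M0_range: "\<And>m::int. 1 \<le> m \<Longrightarrow> m \<le> N - M0 \<Longrightarrow> ereal (of_int m) \<le> ereal (of_int N) - M"
  proof (cases "g j = 0")
    case True
    then have "M = \<infinity>" using j by (simp add: v_t_def)
    then show ?thesis using M_le by (intro that[of N]) auto
  next
    case False
    define z where "z = int (order 0 (fst (quot_of_fract (g j)))) - int (order 0 (snd (quot_of_fract (g j))))"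
    have z: "M = ereal (of_int z)" using j False by (simp add: v_t_def z_def)
    have "ereal (of_int m) \<le> ereal (of_int N) - M" if "m \<le> N - z" for m :: int
    proof -
      have "real_of_int m \<le> of_int N - of_int z" using that by linarith
      then show ?thesis by (simp add: z)
    qed
    then show ?thesis using M_le by (intro that[of z]) (auto simp: z)
  qed
  \<comment> \<open>As the values g_i(p) have valuation at least M0, Bernoulli numbers are needed to
    precision p^K only; K is 0 if N \<le> M0.\<close>
  define K where "K = nat (N - M0)"
  have K_range: "ereal (of_int (int m)) \<le> ereal (of_int N) - M" if "m \<in> {1..K}" for m
    using that by (intro M0_range) (auto simp: K_def)
  define G where "G = (\<lambda>p i. rf_eval (g i) (of_nat p))"
  define F where "F = (\<lambda>p i. of_int (poly (f i) (int p)) :: rat)"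
  note rf_intros = rf_evals_to_add rf_evals_to_diff rf_evals_to_mult rf_evals_to_power rf_evals_to_sum
    rf_evals_to_1 rf_evals_to_const rf_evals_to_t rf_evals_to_inverse_t rf_evals_to_int_poly rf_evals_to_self
  have ev_g: "\<forall>\<^sub>F p in sequentially. \<forall>i\<in>{1..n}. prime p \<longrightarrow> vp_ge p M0 (G p i)"
    unfolding G_def by (intro eventually_ball_finite ballI eventually_vp_ge_rf_eval M0_le) auto
  have ev_0: "\<forall>\<^sub>F p in sequentially. prime p \<longrightarrow> vp_ge p N (G p 0
        - (1 - 1 / of_nat p) * (\<Sum>i | i \<in> {1..n} \<and> poly (f i) 1 = 0. G p i)
        - (\<Sum>i | i \<in> {1..n} \<and> poly (f i) 1 \<ge> 2.
             (1 - of_nat p ^ (nat (poly (f i) 1) - 1))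
             * (bernoulli (nat (poly (f i) 1)) / of_int (poly (f i) 1)) * G p i * F p i))"
    unfolding G_def F_def by (rule eventually_vp_ge_rf_evals_to[OF cond1]) (intro rf_intros)
  \<comment> \<open>Only finitely many k and m occur, so one threshold for p serves all of
    them.\<close>
  have ev_nonpos: "\<forall>\<^sub>F p in sequentially. \<forall>k\<in>{k\<in>ks. even k \<and> k \<le> 0}. \<forall>m\<in>{1..K}. prime p \<longrightarrow>
      vp_ge p (N + 1 - int m) (\<Sum>i | i \<in> {1..n} \<and> poly (f i) 1 = k. G p i * F p i ^ m)"
  proof (intro eventually_ball_finite ballI)
    fix k m assume k: "k \<in> {k\<in>ks. even k \<and> k \<le> 0}" and m: "m \<in> {1..K}"
    have "v_t (\<Sum>i | i \<in> {1..n} \<and> poly (f i) 1 = k. g i * rf_of_int_poly (f i) ^ nat (int m))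
          \<ge> ereal (of_int (N + 1 - int m))"
      using k m K_range[OF m] by (intro cond2) (auto simp: ks_def)
    then show "\<forall>\<^sub>F p in sequentially. prime p \<longrightarrow>
      vp_ge p (N + 1 - int m) (\<Sum>i | i \<in> {1..n} \<and> poly (f i) 1 = k. G p i * F p i ^ m)"
      unfolding G_def F_def nat_int by (rule eventually_vp_ge_rf_evals_to) (intro rf_intros)
  qed (auto simp: ks_def)
  have ev_pos: "\<forall>\<^sub>F p in sequentially. \<forall>k\<in>{k\<in>ks. even k \<and> k > 0}. \<forall>m\<in>{2..K}. prime p \<longrightarrow>
      vp_ge p (N + 1 - int m) (\<Sum>i | i \<in> {1..n} \<and> poly (f i) 1 = k.
        G p i * (F p i ^ m - of_int (k ^ (m - 1)) * F p i))"
  proof (intro eventually_ball_finite ballI)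
    fix k m assume k: "k \<in> {k\<in>ks. even k \<and> k > 0}" and m: "m \<in> {2..K}"
    have m1: "nat (int m - 1) = m - 1" using m by auto
    have "v_t (\<Sum>i | i \<in> {1..n} \<and> poly (f i) 1 = k.
               g i * (rf_of_int_poly (f i) ^ nat (int m)
                      - rf_const (of_int (k ^ nat (int m - 1))) * rf_of_int_poly (f i)))
          \<ge> ereal (of_int (N + 1 - int m))"
      using k m K_range[of m] by (intro cond3) (auto simp: ks_def)
    then show "\<forall>\<^sub>F p in sequentially. prime p \<longrightarrow>
      vp_ge p (N + 1 - int m) (\<Sum>i | i \<in> {1..n} \<and> poly (f i) 1 = k.
        G p i * (F p i ^ m - of_int (k ^ (m - 1)) * F p i))"
      unfolding G_def F_def nat_int m1 by (rule eventually_vp_ge_rf_evals_to) (intro rf_intros)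
  qed (auto simp: ks_def)
  \<comment> \<open>This bound makes \<open>nat\<close> lossless on f_i(p) and provides the size K +
    3 needed in \<open>bernoulli_sum_cong\<close>.\<close>
  have ev_F: "\<forall>\<^sub>F p in sequentially. \<forall>i\<in>{1..n}. int K + 3 \<le> poly (f i) (int p)"
    by (intro eventually_ball_finite ballI eventually_int_poly_ge nonconst lead_pos) auto
  have ev_ks: "\<forall>\<^sub>F p in sequentially. \<forall>k\<in>ks. nat \<bar>k\<bar> + 1 < p"
    by (intro eventually_ball_finite ballI eventually_gt_at_top) (simp add: ks_def)
  have "\<forall>\<^sub>F p in sequentially. prime p \<longrightarrow>
      cong_padic (\<Sum>i = 1..n. G p i * bernoulli (nat (poly (f i) (int p)))) (G p 0) p N"
    using ev_g ev_0 ev_nonpos ev_pos ev_F ev_ks eventually_gt_at_top[of "2 * K + 3"]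
  proof eventually_elim
    case (elim p)
    show ?case
    proof
      assume p: "prime p"
      define x where "x = (\<lambda>i. nat (poly (f i) (int p)))"
      have x: "int (x i) = poly (f i) (int p)" "of_nat (x i) = F p i" if "i \<in> {1..n}" for i
      proof -
        show "int (x i) = poly (f i) (int p)" using elim(5) that by (force simp: x_def)
        then show "of_nat (x i) = F p i" unfolding F_def by (metis of_int_of_nat_eq)
      qed
      define t where "t = (\<lambda>i. bernoulli_main_term p (poly (f i) 1) (G p i) (F p i))"
      have "vp_ge p N (\<Sum>i | i \<in> {1..n} \<and> poly (f i) 1 = k. G p i * bernoulli (x i) - t i)"
        if k: "k \<in> ks" for k
      proof -
        let ?I = "{i. i \<in> {1..n} \<and> poly (f i) 1 = k}"
        have "vp_ge p N (\<Sum>i\<in>?I. G p i * bernoulli (x i) - bernoulli_main_term p k (G p i) (of_nat (x i)))"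
        proof (rule bernoulli_sum_cong[OF p elim(7)])
          show "\<bar>k\<bar> < int p - 1" using elim(6) k by force
          show "N \<le> M0 + int K" by (simp add: K_def)
          show "vp_ge p M0 (G p i)" if "i \<in> ?I" for i using elim(1) p that by blast
          show "K + 3 \<le> x i" if "i \<in> ?I" for i
            using elim(5) that x(1)[of i] by force
          show "[int (x i) = k] (mod (int p - 1))" if "i \<in> ?I" for i
            using dvd_poly_diff[of "int p" 1 "f i"] that x(1)[of i] by (simp add: cong_iff_dvd_diff)
          show "vp_ge p (N + 1 - int m) (\<Sum>i\<in>?I. G p i * of_nat (x i) ^ m)"
            if "even k" "k \<le> 0" "m \<in> {1..K}" for m
          proof -
            have "vp_ge p (N + 1 - int m) (\<Sum>i\<in>?I. G p i * F p i ^ m)"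
              using elim(3) p k that by blast
            also have "(\<Sum>i\<in>?I. G p i * F p i ^ m) = (\<Sum>i\<in>?I. G p i * of_nat (x i) ^ m)"
              by (intro sum.cong refl) (simp add: x)
            finally show ?thesis .
          qed
          show "vp_ge p (N + 1 - int m)
              (\<Sum>i\<in>?I. G p i * (of_nat (x i) ^ m - of_int (k ^ (m - 1)) * of_nat (x i)))"
            if "even k" "k > 0" "m \<in> {2..K}" for m
          proof -
            have "vp_ge p (N + 1 - int m) (\<Sum>i\<in>?I. G p i * (F p i ^ m - of_int (k ^ (m - 1)) * F p i))"
              using elim(4) p k that by blast
            also have "(\<Sum>i\<in>?I. G p i * (F p i ^ m - of_int (k ^ (m - 1)) * F p i)) =
                (\<Sum>i\<in>?I. G p i * (of_nat (x i) ^ m - of_int (k ^ (m - 1)) * of_nat (x i)))"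
              by (intro sum.cong refl) (simp add: x)
            finally show ?thesis .
          qed
        qed
        also have "(\<Sum>i\<in>?I. G p i * bernoulli (x i) - bernoulli_main_term p k (G p i) (of_nat (x i))) =
            (\<Sum>i\<in>?I. G p i * bernoulli (x i) - t i)"
          by (intro sum.cong refl) (simp add: t_def x)
        finally show ?thesis .
      qed
      then have "vp_ge p N (\<Sum>k\<in>ks. \<Sum>i | i \<in> {1..n} \<and> poly (f i) 1 = k. G p i * bernoulli (x i) - t i)"
        by (rule vp_ge_sum[OF p])
      \<comment> \<open>The fibres of i \<mapsto> f_i(1) over \<open>ks\<close> partition the index
        set.\<close>
      also have "(\<Sum>k\<in>ks. \<Sum>i | i \<in> {1..n} \<and> poly (f i) 1 = k. G p i * bernoulli (x i) - t i) =
          (\<Sum>i=1..n. G p i * bernoulli (x i) - t i)"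
        by (rule sum.group) (auto simp: ks_def)
      finally have 1: "vp_ge p N (\<Sum>i=1..n. G p i * bernoulli (x i) - t i)" .
      \<comment> \<open>Main terms vanish outside the classes 0 and k \<ge> 2, so their total is
        what the first condition compares with g_0(p).\<close>
      have "(\<Sum>i=1..n. t i) = (1 - 1 / of_nat p) * (\<Sum>i | i \<in> {1..n} \<and> poly (f i) 1 = 0. G p i)
        + (\<Sum>i | i \<in> {1..n} \<and> poly (f i) 1 \<ge> 2.
             (1 - of_nat p ^ (nat (poly (f i) 1) - 1))
             * (bernoulli (nat (poly (f i) 1)) / of_int (poly (f i) 1)) * G p i * F p i)"
        unfolding sum_distrib_left sum.inter_filter[OF finite_atLeastAtMost] sum.distrib[symmetric]
        by (intro sum.cong refl) (auto simp: t_def bernoulli_main_term_def)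
      then have "vp_ge p N (G p 0 - (\<Sum>i=1..n. t i))"
        using elim(2)[rule_format, OF p] by (simp only: diff_diff_eq)
      from vp_ge_diff[OF p 1 this]
      have "vp_ge p N ((\<Sum>i=1..n. G p i * bernoulli (x i)) - G p 0)"
        by (simp add: sum_subtractf)
      then show "cong_padic (\<Sum>i = 1..n. G p i * bernoulli (nat (poly (f i) (int p)))) (G p 0) p N"
        unfolding x_def by (rule vp_ge_imp_cong_padic[OF p])
    qed
  qed
  then obtain P where "\<And>p. p \<ge> P \<Longrightarrow> prime p \<Longrightarrow>
      cong_padic (\<Sum>i = 1..n. G p i * bernoulli (nat (poly (f i) (int p)))) (G p 0) p N"
    unfolding eventually_sequentially by blast
  then show ?thesis unfolding G_def by (intro exI[of _ P]) auto
qed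

end
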